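(* For every $c>0$, every $\lambda\ge1$ and every one of the six models (Independent set, MAX-CUT, anti-ferromagnetic Ising, $q$-Coloring, K-SAT, NAE-K-SAT), there exists a (model dependent) $z(c)$ such that $$\lim_{N\to\infty}N^{-1}\log Z\big(\mathbb{G}(N,\lfloor cN\rfloor)\big)=z(c)$$ with high probability (in probability), where $z(c)$ is a Lipschitz continuous function of $c$. Moreover $z(c)$ is non-decreasing in $c$ for the MAX-CUT, Coloring, K-SAT and NAE-K-SAT models and non-increasing in $c$ for the Independent set model.
   Context: Let $K\ge 2$, $\chi=\{0,\dots,q-1\}$, $[N]=\{1,\dots,N\}$. $\mathbb{G}(N,M)$: $M$ directed hyperedges chosen independently and uniformly at random (with replacement) from $[N]^K$. For a hypergraph $G=([N],E)$ with node potentials $H_i:\chi\to\mathbb{R}$ and edge potentials $H_e:\chi^K\to\mathbb{R}\cup\{-\infty\}$, $H(x)=\sum_iH_i(x_i)+\sum_{e\in E}H_e(x_e)$ for $x\in\chi^N$, and the partition function is $Z(G)=\sum_{x\in\chi^N}\lambda^{H(x)}$ with $\lambda^{-\infty}=0$. Models: Independent set ($K=2,q=2$, $H_i(1)=1,H_i(0)=0$, $H_e(1,1)=-\infty$, else $0$); MAX-CUT ($K=2,q=2$, $H_i\equiv0$, $H_e(x,y)=\mathbf 1[x\ne y]$); anti-ferromagnetic Ising ($K=2,q=2$, fixed $\beta>0,B\in\mathbb{R}$, $H_i(0)=-B,H_i(1)=B$, $H_e(x,y)=-\beta$ if $x=y$, $\beta$ if $x\neq y$); $q$-Coloring ($K=2$,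 $H_i\equiv0$, $H_e(x,y)=\mathbf 1[x\ne y]$); K-SAT ($q=2$, $H_i\equiv0$, independent uniform $a_e\in\{0,1\}^K$ per hyperedge, $H_e(a_e)=0$, $H_e=1$ otherwise); NAE-K-SAT (same but $H_e(a_e)=H_e(\mathbf1-a_e)=0$, $1$ otherwise). *)

theory Defs
  imports "HOL-Probability.Probability"
begin

text \<open>The six models. Parameters: Ising beta B; Coloring q; KSAT K; NAESAT K.\<close>
datatype model = IndSet | MaxCut | Ising real real | Coloring nat | KSAT nat | NAESAT nat

fun arity :: "model \<Rightarrow> nat" where
  "arity (KSAT K) = K"
| "arity (NAESAT K) = K"
| "arity _ = 2"

text \<open>Alphabet size q, spins are in {0..<q}.\<close>
fun alph :: "model \<Rightarrow> nat" where
  "alph (Coloring q) = q"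
| "alph _ = 2"

fun valid_model :: "model \<Rightarrow> bool" where
  "valid_model (Ising \<beta> B) = (\<beta> > 0)"
| "valid_model (Coloring q) = (q \<ge> 2)"
| "valid_model (KSAT K) = (K \<ge> 2)"
| "valid_model (NAESAT K) = (K \<ge> 2)"
| "valid_model _ = True"

fun node_pot :: "model \<Rightarrow> nat \<Rightarrow> real" where
  "node_pot IndSet v = (if v = 1 then 1 else 0)"
| "node_pot (Ising \<beta> B) v = (if v = 0 then - B else B)"
| "node_pot _ v = 0"

text \<open>Edge potential H_e: given the sign vector a (only used by the SAT models)
  and the values y j = x_(e_j), j < K, of the configuration on the hyperedge.\<close>
fun edge_pot :: "model \<Rightarrow> (nat \<Rightarrow> nat) \<Rightarrow> (nat \<Rightarrow> nat) \<Rightarrow> ereal" where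
  "edge_pot IndSet a y = (if y 0 = 1 \<and> y 1 = 1 then - \<infinity> else 0)"
| "edge_pot MaxCut a y = (if y 0 \<noteq> y 1 then 1 else 0)"
| "edge_pot (Ising \<beta> B) a y = (if y 0 = y 1 then ereal (- \<beta>) else ereal \<beta>)"
| "edge_pot (Coloring q) a y = (if y 0 \<noteq> y 1 then 1 else 0)"
| "edge_pot (KSAT K) a y = (if (\<forall>j<K. y j = a j) then 0 else 1)"
| "edge_pot (NAESAT K) a y =
     (if (\<forall>j<K. y j = a j) \<or> (\<forall>j<K. y j = 1 - a j) then 0 else 1)"

definition lam_pow :: "real \<Rightarrow> ereal \<Rightarrow> real" where
  "lam_pow lam h = (if h = - \<infinity> then 0 else lam powr real_of_ereal h)"

text \<open>A hypergraph instance with M hyperedges on [N] = {1..N}: E e j is the j-th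
  endpoint of hyperedge e (e < M, j < K); a e j is the sign of hyperedge e at position j.\<close>
definition hamiltonian ::
  "model \<Rightarrow> nat \<Rightarrow> nat \<Rightarrow> (nat \<Rightarrow> nat \<Rightarrow> nat) \<Rightarrow> (nat \<Rightarrow> nat \<Rightarrow> nat) \<Rightarrow> (nat \<Rightarrow> nat) \<Rightarrow> ereal" where
  "hamiltonian m N M E a x =
     (\<Sum>i\<in>{1..N}. ereal (node_pot m (x i))) + (\<Sum>e\<in>{0..<M}. edge_pot m (a e) (\<lambda>j. x (E e j)))"

definition configs :: "model \<Rightarrow> nat \<Rightarrow> (nat \<Rightarrow> nat) set" where
  "configs m N = {1..N} \<rightarrow>\<^sub>E {0..<alph m}"

definition partition_fun ::
  "model \<Rightarrow> real \<Rightarrow> nat \<Rightarrow> nat \<Rightarrow> (nat \<Rightarrow> nat \<Rightarrow> nat) \<Rightarrow> (nat \<Rightarrow> nat \<Rightarrow> nat) \<Rightarrow> real" where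
  "partition_fun m lam N M E a = (\<Sum>x\<in>configs m N. lam_pow lam (hamiltonian m N M E a x))"

text \<open>Sample space of G(N,M): M hyperedges, each uniform in [N]^K, i.i.d. (with replacement),
  together with independent uniform sign vectors in {0,1}^K (used only by K-SAT / NAE-K-SAT).\<close>
definition edge_space :: "model \<Rightarrow> nat \<Rightarrow> nat \<Rightarrow> (nat \<Rightarrow> nat \<Rightarrow> nat) set" where
  "edge_space m N M = {0..<M} \<rightarrow>\<^sub>E ({0..<arity m} \<rightarrow>\<^sub>E {1..N})"

definition sign_space :: "model \<Rightarrow> nat \<Rightarrow> (nat \<Rightarrow> nat \<Rightarrow> nat) set" where
  "sign_space m M = {0..<M} \<rightarrow>\<^sub>E ({0..<arity m} \<rightarrow>\<^sub>E {0..<2})"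

definition random_instance :: "model \<Rightarrow> nat \<Rightarrow> nat \<Rightarrow> ((nat \<Rightarrow> nat \<Rightarrow> nat) \<times> (nat \<Rightarrow> nat \<Rightarrow> nat)) pmf" where
  "random_instance m N M = pmf_of_set (edge_space m N M \<times> sign_space m M)"

definition free_energy_conv_in_prob :: "model \<Rightarrow> real \<Rightarrow> real \<Rightarrow> real \<Rightarrow> bool" where
  "free_energy_conv_in_prob m lam c zc \<longleftrightarrow>
     (\<forall>\<epsilon>>0. (\<lambda>N. measure_pmf.prob (random_instance m N (nat \<lfloor>c * real N\<rfloor>))
                 {(E, a). \<bar>ln (partition_fun m lam N (nat \<lfloor>c * real N\<rfloor>) E a) / real N - zc\<bar> > \<epsilon>})
             \<longlonglongrightarrow> 0)"

end

theory Submission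
  imports Defs
begin

text \<open>
  The argument is the combinatorial interpolation method of Bayati, Gamarnik and Tetali.
  Every edge weight has the form \<open>A (1 - B f)\<close> with \<open>f\<close> a sum of products of nonnegative
  functions of the single endpoints.  Expanding \<open>log (1 - t)\<close> and writing the powers of a Gibbs
  average by replicas, Jensen's inequality for \<open>t ^ K\<close> shows that forcing one random edge to stay
  inside a block of a vertex partition can only decrease the expected \<open>log Z\<close>.  Doing this for
  all edges with blocks of size \<open>n\<close> factorises \<open>Z\<close>, and each block receives a binomial number
  of edges, which is within \<open>O(sqrt n)\<close> of \<open>c n\<close> on average.  Since one edge changes \<open>log Z\<close> by
  a bounded amount, this yields \<open>liminf a N / N \<ge> a n / n - O(1 / sqrt n)\<close> for every \<open>n\<close>, where
  \<open>a N\<close> is the expected \<open>log Z\<close>; hence \<open>a N / N\<close> converges.  The bounded effect of an edge also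
  gives variance \<open>O(N)\<close> (so convergence in probability), the Lipschitz bound and monotonicity.
\<close>

subsection \<open>Replicas and Jensen's inequality\<close>

text \<open>Only two numbers per model enter: a further edge multiplies Z by a factor between
  \<open>c0\<close> and \<open>A\<close>, and \<open>ln c0\<close> and \<open>ln A\<close> bound the
  slope of the limit from both sides. The obstacle is the independent set model, where an edge may
  have weight zero: there \<open>c0\<close> cannot be read off a single edge weight and has to be
  found for Z as a whole. Until the very end the random hypergraph is not treated as a measure.
  Edges form a multiset and expectation is an averaging operator on functions of multisets; such
  operators commute, which is what allows edges to be exchanged one at a time. Signs are attached to
  the edges of every model, so that an edge is always a uniform element of one finite set. Many
  blocks of one size, instead of two parts split again and again, are used so that the deviation of
  a block is paid once per block and no errors accumulate along a recursion.\<close>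

definition edges_on :: "nat \<Rightarrow> nat set \<Rightarrow> ((nat \<Rightarrow> nat) \<times> (nat \<Rightarrow> nat)) set" where
  "edges_on K U = ({0..<K} \<rightarrow>\<^sub>E U) \<times> ({0..<K} \<rightarrow>\<^sub>E {0..<2})"

definition avg :: "'a set \<Rightarrow> ('a \<Rightarrow> real) \<Rightarrow> real" where
  "avg X f = (\<Sum>x\<in>X. f x) / real (card X)"

lemma avg_mono: "(\<And>x. x \<in> X \<Longrightarrow> f x \<le> g x) \<Longrightarrow> avg X f \<le> avg X g"
  unfolding avg_def by (intro divide_right_mono sum_mono) auto

lemma avg_cong: "(\<And>x. x \<in> X \<Longrightarrow> f x = g x) \<Longrightarrow> avg X f = avg X g"
  unfolding avg_def by (simp cong: sum.cong)

lemma avg_lincomb: "avg X (\<lambda>x. \<alpha> * f x + \<beta> * g x) = \<alpha> * avg X f + \<beta> * avg X g"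
  unfolding avg_def by (simp add: sum.distrib sum_distrib_left add_divide_distrib)

lemma avg_cmult: "avg X (\<lambda>x. \<alpha> * f x) = \<alpha> * avg X f"
  unfolding avg_def by (simp add: sum_distrib_left)

lemma avg_add: "avg X (\<lambda>x. f x + g x) = avg X f + avg X g"
  unfolding avg_def by (simp add: sum.distrib add_divide_distrib)

lemma avg_diff: "avg X (\<lambda>x. f x - g x) = avg X f - avg X g"
  unfolding avg_def by (simp add: sum_subtractf diff_divide_distrib)

lemma avg_const: "finite X \<Longrightarrow> X \<noteq> {} \<Longrightarrow> avg X (\<lambda>x. \<alpha>) = \<alpha>"
  unfolding avg_def by (simp add: card_gt_0_iff)

lemma avg_sum: "avg X (\<lambda>x. \<Sum>b\<in>I. f b x) = (\<Sum>b\<in>I. avg X (f b))"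
  unfolding avg_def by (subst sum.swap) (simp add: sum_divide_distrib)

lemma avg_swap: "avg X (\<lambda>x. avg Y (f x)) = avg Y (\<lambda>y. avg X (\<lambda>x. f x y))"
  unfolding avg_def by (subst sum.swap[of _ X Y, simplified] sum_divide_distrib[symmetric])+
    (simp add: sum_divide_distrib[symmetric] sum.swap[of _ X Y] mult.commute)

lemma sums_avg:
  assumes "\<And>x. x \<in> X \<Longrightarrow> (f x) sums (l x)"
  shows "(\<lambda>k. avg X (\<lambda>x. f x k)) sums avg X l"
  unfolding avg_def by (intro sums_divide sums_sum assms)

lemma finite_edges_on [simp]: "finite U \<Longrightarrow> finite (edges_on K U)"
  by (simp add: edges_on_def finite_PiE)

lemma edges_on_nonempty: "U \<noteq> {} \<Longrightarrow> edges_on K U \<noteq> {}"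
  by (auto simp: edges_on_def PiE_eq_empty_iff)

lemma card_edges_on: "finite U \<Longrightarrow> card (edges_on K U) = (2 * card U) ^ K"
  by (simp add: edges_on_def card_cartesian_product card_PiE power_mult_distrib)

lemma edges_on_mono: "U \<subseteq> V \<Longrightarrow> edges_on K U \<subseteq> edges_on K V"
  unfolding edges_on_def by (auto dest: PiE_mem simp: PiE_iff)

lemma edges_on_disjoint: "K > 0 \<Longrightarrow> U \<inter> V = {} \<Longrightarrow> edges_on K U \<inter> edges_on K V = {}"
  by (auto simp: edges_on_def PiE_iff dest!: bspec[of _ _ 0])

lemma sum_power_replicas:
  fixes \<tau> :: "'a \<Rightarrow> real"
  assumes "finite X"
  shows "(\<Sum>x\<in>X. \<tau> x) ^ k = (\<Sum>\<sigma>\<in>{0..<k} \<rightarrow>\<^sub>E X. \<Prod>l\<in>{0..<k}. \<tau> (\<sigma> l))"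
  using prod_sum_PiE[of "{0..<k}" "\<lambda>_. X" "\<lambda>_. \<tau>"] assms by simp

text \<open>Under the uniform choice of an edge the \<open>K\<close> pairs of endpoint and sign are
  independent and identically distributed, so a product over positions becomes a \<open>K\<close>-th
  power.\<close>

lemma sum_edges_on_prod:
  fixes \<phi> :: "nat \<Rightarrow> nat \<Rightarrow> real"
  assumes "finite U"
  shows "(\<Sum>e\<in>edges_on K U. \<Prod>j\<in>{0..<K}. \<phi> (fst e j) (snd e j)) = (\<Sum>i\<in>U. \<Sum>b\<in>{0..<2}. \<phi> i b) ^ K"
proof -
  have "(\<Sum>e\<in>edges_on K U. \<Prod>j\<in>{0..<K}. \<phi> (fst e j) (snd e j))
      = (\<Sum>E\<in>{0..<K} \<rightarrow>\<^sub>E U. \<Sum>a\<in>{0..<K} \<rightarrow>\<^sub>E {0..<2}. \<Prod>j\<in>{0..<K}. \<phi> (E j) (a j))"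
    unfolding edges_on_def by (simp add: sum.cartesian_product case_prod_beta)
  also have "\<dots> = (\<Sum>E\<in>{0..<K} \<rightarrow>\<^sub>E U. \<Prod>j\<in>{0..<K}. \<Sum>b\<in>{0..<2}. \<phi> (E j) b)"
    by (intro sum.cong refl, subst prod_sum_PiE) auto
  also have "\<dots> = (\<Sum>i\<in>U. \<Sum>b\<in>{0..<2}. \<phi> i b) ^ K"
    by (rule sum_power_replicas[OF assms, symmetric])
  finally show ?thesis .
qed

text \<open>A replica is a pair of a configuration and a class index. With the \<open>k\<close>
  replicas fixed, the products over positions and over replicas are exchanged, and what remains is
  the \<open>K\<close>-th power of an average over one vertex and one sign; hence the denominator
  \<open>2 * card U\<close>.\<close>

lemma avg_edges_power:
  fixes \<mu> :: "(nat \<Rightarrow> nat) \<Rightarrow> real" and g :: "'s \<Rightarrow> nat \<Rightarrow> nat \<Rightarrow> real"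
  assumes "finite U" "finite X" "finite S"
  shows "avg (edges_on K U) (\<lambda>e. (\<Sum>(x,s)\<in>X \<times> S. \<mu> x * (\<Prod>j\<in>{0..<K}. g s (snd e j) (x (fst e j)))) ^ k)
       = (\<Sum>\<sigma>\<in>{0..<k} \<rightarrow>\<^sub>E X \<times> S. (\<Prod>l\<in>{0..<k}. \<mu> (fst (\<sigma> l))) *
            ((\<Sum>i\<in>U. \<Sum>b\<in>{0..<2}. \<Prod>l\<in>{0..<k}. g (snd (\<sigma> l)) b (fst (\<sigma> l) i)) / (2 * real (card U))) ^ K)"
proof -
  have "(\<Sum>e\<in>edges_on K U. (\<Sum>(x,s)\<in>X \<times> S. \<mu> x * (\<Prod>j\<in>{0..<K}. g s (snd e j) (x (fst e j)))) ^ k)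
     = (\<Sum>e\<in>edges_on K U. \<Sum>\<sigma>\<in>{0..<k} \<rightarrow>\<^sub>E X \<times> S. (\<Prod>l\<in>{0..<k}. \<mu> (fst (\<sigma> l))) *
         (\<Prod>j\<in>{0..<K}. \<Prod>l\<in>{0..<k}. g (snd (\<sigma> l)) (snd e j) (fst (\<sigma> l) (fst e j))))"
    by (subst sum_power_replicas)
       (use assms in \<open>auto intro!: sum.cong prod.cong simp: prod.distrib case_prod_beta prod.swap[of _ "{0..<K}"]\<close>)
  also have "\<dots> = (\<Sum>\<sigma>\<in>{0..<k} \<rightarrow>\<^sub>E X \<times> S. (\<Prod>l\<in>{0..<k}. \<mu> (fst (\<sigma> l))) *
         (\<Sum>e\<in>edges_on K U. \<Prod>j\<in>{0..<K}. \<Prod>l\<in>{0..<k}. g (snd (\<sigma> l)) (snd e j) (fst (\<sigma> l) (fst e j))))"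
    by (subst sum.swap) (simp add: sum_distrib_left)
  also have "\<dots> = (\<Sum>\<sigma>\<in>{0..<k} \<rightarrow>\<^sub>E X \<times> S. (\<Prod>l\<in>{0..<k}. \<mu> (fst (\<sigma> l))) *
         (\<Sum>i\<in>U. \<Sum>b\<in>{0..<2}. \<Prod>l\<in>{0..<k}. g (snd (\<sigma> l)) b (fst (\<sigma> l) i)) ^ K)"
    by (intro sum.cong refl arg_cong2[where f = "(*)"] sum_edges_on_prod[OF assms(1),
      where \<phi> = "\<lambda>i b. \<Prod>l\<in>{0..<k}. g (snd (_ l)) b (fst (_ l) i)"])
  finally show ?thesis
    unfolding avg_def power_divide times_divide_eq_right sum_divide_distrib[symmetric]
    by (simp add: card_edges_on assms power_mult_distrib)
qed

text \<open>Odd powers greater than 1 are convex on the half line only, which is why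
  \<open>g\<close> is required to be nonnegative.\<close>

lemma convex_on_power_nonneg: "convex_on {0::real..} (\<lambda>x. x ^ n)"
  by (cases "even n")
     (auto intro: convex_power_odd convex_on_subset[OF convex_power_even])

lemma sum_blocks:
  fixes f :: "'a \<Rightarrow> real"
  assumes "finite V"
  shows "(\<Sum>b\<in>blk ` V. \<Sum>i\<in>{i\<in>V. blk i = b}. f i) = (\<Sum>i\<in>V. f i)"
  using sum.image_gen[OF assms, of f blk] by simp

text \<open>The mean over \<open>V\<close> is the mean of the block means weighted by block size, so
  this is Jensen's inequality. The factor 2 counts the signs, which are already summed inside \<phi>
  when the lemma is used.\<close>

lemma power_avg_le_blocks:
  fixes \<phi> :: "'a \<Rightarrow> real" and blk :: "'a \<Rightarrow> 'b"
  assumes V: "finite V" "V \<noteq> {}" and \<phi>: "\<And>i. i \<in> V \<Longrightarrow> \<phi> i \<ge> 0"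
  shows "((\<Sum>i\<in>V. \<phi> i) / (2 * real (card V))) ^ K
    \<le> (\<Sum>b\<in>blk ` V. real (card {i\<in>V. blk i = b}) / real (card V) *
         ((\<Sum>i\<in>{i\<in>V. blk i = b}. \<phi> i) / (2 * real (card {i\<in>V. blk i = b}))) ^ K)"
proof -
  let ?B = "\<lambda>b. {i\<in>V. blk i = b}"
  let ?p = "\<lambda>b. real (card (?B b)) / real (card V)"
  let ?y = "\<lambda>b. (\<Sum>i\<in>?B b. \<phi> i) / (2 * real (card (?B b)))"
  have cV: "card V > 0" using V by (simp add: card_gt_0_iff)
  have cB: "card (?B b) > 0" if "b \<in> blk ` V" for b
    using that V by (auto simp: card_gt_0_iff)
  have s1: "(\<Sum>b\<in>blk ` V. ?p b) = 1"
    using sum_blocks[OF V(1), where blk = blk and f = "\<lambda>_. 1"] cV by (simp add: sum_divide_distrib[symmetric])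
  have "(\<Sum>b\<in>blk ` V. ?p b *\<^sub>R ?y b) = (\<Sum>b\<in>blk ` V. (\<Sum>i\<in>?B b. \<phi> i) / (2 * real (card V)))"
    by (intro sum.cong refl) (use cB in \<open>fastforce simp: field_simps\<close>)
  also have "\<dots> = (\<Sum>i\<in>V. \<phi> i) / (2 * real (card V))"
    using sum_blocks[OF V(1), where blk = blk and f = \<phi>] by (simp add: sum_divide_distrib[symmetric])
  finally have eq: "(\<Sum>b\<in>blk ` V. ?p b *\<^sub>R ?y b) = (\<Sum>i\<in>V. \<phi> i) / (2 * real (card V))" .
  have "(\<Sum>b\<in>blk ` V. ?p b *\<^sub>R ?y b) ^ K \<le> (\<Sum>b\<in>blk ` V. ?p b * ?y b ^ K)"
    using V \<phi> by (intro convex_on_sum[OF _ _ convex_on_power_nonneg s1])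
      (auto intro!: divide_nonneg_nonneg sum_nonneg)
  thus ?thesis unfolding eq .
qed

text \<open>Jensen's inequality is applied for each choice of replicas; the coefficients are
  products of values of \<mu>, hence nonnegative, and the inequalities add up.\<close>

lemma avg_edges_power_le_blocks:
  fixes \<mu> :: "(nat \<Rightarrow> nat) \<Rightarrow> real" and g :: "'s \<Rightarrow> nat \<Rightarrow> nat \<Rightarrow> real" and blk :: "nat \<Rightarrow> 'b"
    and K :: nat
  assumes "finite V" "V \<noteq> {}" "finite X" "finite S"
    and \<mu>: "\<And>x. x \<in> X \<Longrightarrow> \<mu> x \<ge> 0" and g: "\<And>s b v. g s b v \<ge> 0"
  defines "f \<equiv> \<lambda>e. \<Sum>(x,s)\<in>X \<times> S. \<mu> x * (\<Prod>j\<in>{0..<K}. g s (snd e j) (x (fst e j)))"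
  shows "avg (edges_on K V) (\<lambda>e. f e ^ k)
    \<le> (\<Sum>b\<in>blk ` V. real (card {i\<in>V. blk i = b}) / real (card V) *
          avg (edges_on K {i\<in>V. blk i = b}) (\<lambda>e. f e ^ k))"
proof -
  let ?B = "\<lambda>b. {i\<in>V. blk i = b}"
  let ?\<phi> = "\<lambda>\<sigma> i. \<Sum>b\<in>{0..<2}. \<Prod>l\<in>{0..<k}. g (snd (\<sigma> l)) b (fst (\<sigma> l) i)"
  let ?m = "\<lambda>\<sigma>. \<Prod>l\<in>{0..<k}. \<mu> (fst (\<sigma> l))"
  let ?P = "{0..<k} \<rightarrow>\<^sub>E X \<times> S"
  have "avg (edges_on K V) (\<lambda>e. f e ^ k)
      = (\<Sum>\<sigma>\<in>?P. ?m \<sigma> * ((\<Sum>i\<in>V. ?\<phi> \<sigma> i) / (2 * real (card V))) ^ K)"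
    unfolding f_def by (rule avg_edges_power) (use assms in auto)
  also have "\<dots> \<le> (\<Sum>\<sigma>\<in>?P. ?m \<sigma> * (\<Sum>b\<in>blk ` V. real (card (?B b)) / real (card V) *
         ((\<Sum>i\<in>?B b. ?\<phi> \<sigma> i) / (2 * real (card (?B b)))) ^ K))"
    by (intro sum_mono mult_left_mono power_avg_le_blocks prod_nonneg sum_nonneg)
       (use assms in \<open>auto intro!: prod_nonneg g \<mu> simp: mem_Times_iff dest!: PiE_mem\<close>)
  also have "\<dots> = (\<Sum>b\<in>blk ` V. real (card (?B b)) / real (card V) *
         (\<Sum>\<sigma>\<in>?P. ?m \<sigma> * ((\<Sum>i\<in>?B b. ?\<phi> \<sigma> i) / (2 * real (card (?B b)))) ^ K))"
    unfolding sum_distrib_left by (subst sum.swap) (simp add: mult_ac)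
  also have "\<dots> = (\<Sum>b\<in>blk ` V. real (card (?B b)) / real (card V) *
          avg (edges_on K (?B b)) (\<lambda>e. f e ^ k))"
    unfolding f_def by (subst avg_edges_power) (use assms in auto)
  finally show ?thesis .
qed

subsection \<open>Interpolation between one system and its blocks\<close>

text \<open>Weights multiply instead of potentials adding, so a potential of minus infinity is an
  ordinary factor 0. A multiset records repeated edges and forgets their order.\<close>

definition gibbs_Z ::
  "(nat \<Rightarrow> real) \<Rightarrow> nat \<Rightarrow> ((nat \<Rightarrow> nat) \<times> (nat \<Rightarrow> nat) \<Rightarrow> (nat \<Rightarrow> nat) \<Rightarrow> real) \<Rightarrow> nat set
    \<Rightarrow> ((nat \<Rightarrow> nat) \<times> (nat \<Rightarrow> nat)) multiset \<Rightarrow> real" where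
  "gibbs_Z h q w U es = (\<Sum>x\<in>U \<rightarrow>\<^sub>E {0..<q}. (\<Prod>i\<in>U. h (x i)) * (\<Prod>e\<in>#es. w e x))"

text \<open>In the applications \<open>A\<close> is the greater edge weight and
  \<open>A * (1 - B)\<close> the smaller one. \<open>Z_lower\<close> speaks of Z and not of
  \<open>w\<close>, because with hard constraints \<open>w\<close> may vanish while Z keeps a fixed
  fraction. The set \<open>U\<close> varies in the assumptions since the same \<open>w\<close>
  serves the whole system and each of its blocks.\<close>

locale interpolation =
  fixes K q :: nat and h :: "nat \<Rightarrow> real"
    and w :: "(nat \<Rightarrow> nat) \<times> (nat \<Rightarrow> nat) \<Rightarrow> (nat \<Rightarrow> nat) \<Rightarrow> real"
    and S :: "nat set" and g :: "nat \<Rightarrow> nat \<Rightarrow> nat \<Rightarrow> real" and A B c0 :: real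
  assumes K_pos: "K > 0" and q_pos: "q > 0" and h_pos: "\<And>v. v < q \<Longrightarrow> h v > 0"
    and finite_S: "finite S" and g_nonneg: "\<And>s b v. g s b v \<ge> 0"
    and A_pos: "A > 0" and B_nonneg: "B \<ge> 0" and c0_pos: "c0 > 0"
    and w_eq: "\<And>U e x. e \<in> edges_on K U \<Longrightarrow> x \<in> U \<rightarrow> {0..<q} \<Longrightarrow>
       w e x = A * (1 - B * (\<Sum>s\<in>S. \<Prod>j\<in>{0..<K}. g s (snd e j) (x (fst e j))))"
    and w_nonneg: "\<And>U e x. e \<in> edges_on K U \<Longrightarrow> x \<in> U \<rightarrow> {0..<q} \<Longrightarrow> w e x \<ge> 0"
    and Z_lower: "\<And>U e es. finite U \<Longrightarrow> set_mset es \<subseteq> edges_on K U \<Longrightarrow> e \<in> edges_on K U \<Longrightarrow>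
       c0 * gibbs_Z h q w U es \<le> gibbs_Z h q w U (add_mset e es)"
begin

abbreviation "Z \<equiv> gibbs_Z h q w"
abbreviation "adm U es \<equiv> set_mset es \<subseteq> edges_on K U"

definition L where "L U es = ln (Z U es)"

text \<open>\<open>T U\<close> takes the expectation over one further edge, uniform on \<open>U\<close>; the expectation over
  \<open>G(N, M)\<close> is \<open>T {1..N} ^^ M\<close> evaluated at the empty multiset.\<close>

definition T where "T U F es = avg (edges_on K U) (\<lambda>e. F (add_mset e es))"

text \<open>By \<open>Z_lower\<close> positivity survives every edge even if single configurations
  are ruled out, so no logarithm is taken at 0.\<close>

lemma Z_pos:
  assumes "finite U" "adm U es" shows "Z U es > 0"
  using assms(2)
proof (induction es)
  case empty
  have "(U \<rightarrow>\<^sub>E {0..<q}) \<noteq> {}" using q_pos by (simp add: PiE_eq_empty_iff)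
  moreover have "finite (U \<rightarrow>\<^sub>E {0..<q})" using assms by (simp add: finite_PiE)
  ultimately show ?case unfolding gibbs_Z_def
    by (intro sum_pos) (auto intro!: prod_pos h_pos simp: PiE_iff)
next
  case (add e es)
  have "0 < c0 * Z U es" using add c0_pos by simp
  also have "\<dots> \<le> Z U (add_mset e es)" using add.prems assms by (intro Z_lower) auto
  finally show ?case .
qed

lemma gibbs_weight_nonneg:
  assumes "adm U es" "x \<in> U \<rightarrow>\<^sub>E {0..<q}"
  shows "(\<Prod>i\<in>U. h (x i)) * (\<Prod>e\<in>#es. w e x) \<ge> 0"
proof -
  have "x \<in> U \<rightarrow> {0..<q}" using assms by (auto simp: PiE_iff)
  hence "(\<Prod>e\<in>#es. w e x) \<ge> 0" using assms(1)
    by (induction es) (auto intro!: mult_nonneg_nonneg w_nonneg)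
  moreover have "(\<Prod>i\<in>U. h (x i)) \<ge> 0"
    using assms(2) by (intro prod_nonneg) (auto simp: PiE_iff intro!: less_imp_le[OF h_pos])
  ultimately show ?thesis by simp
qed

lemma w_le:
  assumes "e \<in> edges_on K U" "x \<in> U \<rightarrow> {0..<q}"
  shows "w e x \<le> A"
proof -
  have "0 \<le> B * (\<Sum>s\<in>S. \<Prod>j\<in>{0..<K}. g s (snd e j) (x (fst e j)))"
    by (intro mult_nonneg_nonneg B_nonneg sum_nonneg prod_nonneg) (auto intro: g_nonneg)
  thus ?thesis unfolding w_eq[OF assms] using A_pos by (simp add: mult_le_cancel_left1)
qed

lemma Z_upper:
  assumes "finite U" "adm U es" "e \<in> edges_on K U"
  shows "Z U (add_mset e es) \<le> A * Z U es"
  unfolding gibbs_Z_def sum_distrib_left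
proof (intro sum_mono)
  fix x assume x: "x \<in> U \<rightarrow>\<^sub>E {0..<q}"
  have "w e x \<le> A" using x assms by (intro w_le) (auto simp: PiE_iff)
  from mult_right_mono[OF this gibbs_weight_nonneg[OF assms(2) x]]
  show "(\<Prod>i\<in>U. h (x i)) * (\<Prod>e'\<in>#add_mset e es. w e' x)
     \<le> A * ((\<Prod>i\<in>U. h (x i)) * (\<Prod>e\<in>#es. w e x))"
    by (simp add: mult_ac)
qed

lemma L_add_bounds:
  assumes "finite U" "adm U es" "e \<in> edges_on K U"
  shows "L U es + ln c0 \<le> L U (add_mset e es)" "L U (add_mset e es) \<le> L U es + ln A"
proof -
  have p: "Z U es > 0" "Z U (add_mset e es) > 0" using Z_pos assms by auto
  show "L U es + ln c0 \<le> L U (add_mset e es)"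
    using Z_lower[OF assms] p c0_pos unfolding L_def
    by (subst add.commute, subst ln_mult_pos[symmetric]) auto
  show "L U (add_mset e es) \<le> L U es + ln A"
    using Z_upper[OF assms] p A_pos unfolding L_def
    by (subst add.commute, subst ln_mult_pos[symmetric]) auto
qed

lemma T_mono:
  assumes "\<And>es. adm V es \<Longrightarrow> F es \<le> G es" "U \<subseteq> V" "adm V es"
  shows "T U F es \<le> T U G es"
  unfolding T_def using assms edges_on_mono[OF assms(2), of K] by (intro avg_mono assms(1)) auto

lemma T_lincomb: "T U (\<lambda>es. \<alpha> * F es + \<beta> * G es) es = \<alpha> * T U F es + \<beta> * T U G es"
  unfolding T_def by (rule avg_lincomb)

text \<open>In a multiset it does not matter which of two edges is drawn first; this lets an edge on
  \<open>V\<close> pass the edges confined to blocks.\<close>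

lemma T_commute: "T U (T V F) es = T V (T U F) es"
  unfolding T_def by (subst avg_swap) (simp add: add_mset_commute)

lemma T_sum: "T U (\<lambda>es. \<Sum>b\<in>I. p b * F b es) es = (\<Sum>b\<in>I. p b * T U (F b) es)"
  unfolding T_def by (simp add: avg_sum avg_cmult)

definition share :: "nat set \<Rightarrow> (nat \<Rightarrow> nat) \<Rightarrow> nat \<Rightarrow> real" where
  "share V blk b = real (card {i\<in>V. blk i = b}) / real (card V)"

text \<open>The further edge first picks a block with probability proportional to its size and is then
  uniform on that block.\<close>

definition TS where
  "TS V blk F es = (\<Sum>b\<in>blk ` V. share V blk b * T {i\<in>V. blk i = b} F es)"

lemma share_nonneg: "share V blk b \<ge> 0"
  by (simp add: share_def)

lemma sum_share:
  assumes "finite V" "V \<noteq> {}" shows "(\<Sum>b\<in>blk ` V. share V blk b) = 1"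
  using sum_blocks[OF assms(1), where blk = blk and f = "\<lambda>_. 1"] assms
  by (simp add: share_def sum_divide_distrib[symmetric] card_gt_0_iff)

lemma TS_mono:
  assumes "\<And>es. adm V es \<Longrightarrow> F es \<le> G es" "adm V es"
  shows "TS V blk F es \<le> TS V blk G es"
  unfolding TS_def by (intro sum_mono mult_left_mono T_mono[of V] assms share_nonneg) auto

lemma TS_pow_mono:
  assumes "\<And>es. adm V es \<Longrightarrow> F es \<le> G es" "adm V es"
  shows "(TS V blk ^^ M) F es \<le> (TS V blk ^^ M) G es"
  using assms(2) by (induction M arbitrary: es) (auto intro!: assms TS_mono)

lemma T_TS_commute: "T V (TS V blk F) es = TS V blk (T V F) es"
proof -
  have "T V (TS V blk F) es = (\<Sum>b\<in>blk ` V. share V blk b * T V (T {i\<in>V. blk i = b} F) es)"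
    using T_sum[of V "\<lambda>b. share V blk b" "\<lambda>b. T {i\<in>V. blk i = b} F" "blk ` V" es]
    by (simp add: TS_def[abs_def])
  thus ?thesis by (simp add: TS_def T_commute[of V])
qed

lemma T_TS_pow_commute: "T V ((TS V blk ^^ M) F) = (TS V blk ^^ M) (T V F)"
proof (induction M)
  case (Suc M)
  have "T V (TS V blk G) = TS V blk (T V G)" for G by (rule ext) (rule T_TS_commute)
  thus ?case using Suc by simp
qed simp

text \<open>The logarithm is expanded into its power series; the \<open>k\<close>-th moment of the edge overlap is a
  positive combination over \<open>k\<close> replicas of \<open>K\<close>-th powers of averages over the vertices, to which
  Jensen's inequality applies.\<close>

lemma TS_L_le_T_L:
  assumes V: "finite V" "V \<noteq> {}" and es: "adm V es"
  shows "TS V blk (L V) es \<le> T V (L V) es"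
proof -
  define X where "X = V \<rightarrow>\<^sub>E {0..<q}"
  define \<rho> where "\<rho> x = (\<Prod>i\<in>V. h (x i)) * (\<Prod>e\<in>#es. w e x)" for x
  \<comment> \<open>\<mu> is the Gibbs measure before the new edge; \<open>t e\<close> below is the
    fraction of \<open>A * Z V es\<close> that is lost when \<open>e\<close> is added.\<close>
  define \<mu> where "\<mu> x = \<rho> x / Z V es" for x
  define f where "f e = (\<Sum>(x,s)\<in>X \<times> S. \<mu> x * (\<Prod>j\<in>{0..<K}. g s (snd e j) (x (fst e j))))" for e
  define t where "t e = B * f e" for e
  let ?B = "\<lambda>b. {i\<in>V. blk i = b}"
  have finX: "finite X" using V by (simp add: X_def finite_PiE)
  have Zp: "Z V es > 0" using Z_pos V es by auto
  have \<mu>0: "\<mu> x \<ge> 0" if "x \<in> X" for x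
    using gibbs_weight_nonneg[OF es] that Zp by (simp add: \<mu>_def \<rho>_def X_def)
  have Z\<mu>: "\<rho> x = Z V es * \<mu> x" for x using Zp by (simp add: \<mu>_def)
  have Zsum: "Z V es = (\<Sum>x\<in>X. \<rho> x)" by (simp add: gibbs_Z_def \<rho>_def X_def)
  have \<mu>1: "(\<Sum>x\<in>X. \<mu> x) = 1"
    using Zp by (simp add: \<mu>_def sum_divide_distrib[symmetric] Zsum)
  have Zadd: "Z V (add_mset e es) = A * Z V es * (1 - t e)" if e: "e \<in> edges_on K V" for e
  proof -
    have "Z V (add_mset e es) = (\<Sum>x\<in>X. \<rho> x * w e x)"
      by (simp add: gibbs_Z_def \<rho>_def X_def mult_ac)
    also have "\<dots> = (\<Sum>x\<in>X. A * Z V es * (\<mu> x - B * (\<Sum>s\<in>S. \<mu> x * (\<Prod>j\<in>{0..<K}. g s (snd e j) (x (fst e j))))))"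
    proof (intro sum.cong refl)
      fix x assume "x \<in> X"
      hence we: "w e x = A * (1 - B * (\<Sum>s\<in>S. \<Prod>j\<in>{0..<K}. g s (snd e j) (x (fst e j))))"
        using e by (intro w_eq[of e V]) (auto simp: X_def PiE_iff)
      thus "\<rho> x * w e x = A * Z V es * (\<mu> x - B * (\<Sum>s\<in>S. \<mu> x * (\<Prod>j\<in>{0..<K}. g s (snd e j) (x (fst e j)))))"
        unfolding we Z\<mu> by (simp add: sum_distrib_left[symmetric] algebra_simps)
    qed
    also have "\<dots> = A * Z V es * (1 - t e)"
      unfolding sum_distrib_left[symmetric] sum_subtractf \<mu>1
      by (simp add: t_def f_def sum.cartesian_product[symmetric] sum_distrib_left)
    finally show ?thesis .
  qed
  have f0: "f e \<ge> 0" for e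
    unfolding f_def by (auto intro!: sum_nonneg mult_nonneg_nonneg \<mu>0 prod_nonneg g_nonneg)
  have t0: "t e \<ge> 0" for e by (simp add: t_def f0 B_nonneg)
  \<comment> \<open>Strictness comes from the positivity of Z after adding \<open>e\<close>, and
    makes the logarithm series converge.\<close>
  have t1: "t e < 1" if "e \<in> edges_on K V" for e
  proof -
    have "0 < Z V (add_mset e es)" using that es V by (intro Z_pos) auto
    hence "0 < A * Z V es * (1 - t e)" by (simp only: Zadd[OF that])
    moreover have "0 < A * Z V es" using Zp A_pos by simp
    ultimately have "0 < 1 - t e" by (rule zero_less_mult_pos)
    thus ?thesis by simp
  qed
  have Leq: "L V (add_mset e es) = ln (A * Z V es) + ln (1 - t e)" if "e \<in> edges_on K V" for e
    using t1[OF that] Zp A_pos unfolding L_def Zadd[OF that] by (subst ln_mult_pos) auto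
  have sub: "edges_on K (?B b) \<subseteq> edges_on K V" for b by (rule edges_on_mono) auto
  have TL: "T U (L V) es = ln (A * Z V es) + avg (edges_on K U) (\<lambda>e. ln (1 - t e))"
    if "U \<subseteq> V" "U \<noteq> {}" for U
  proof -
    have "finite U" using that V finite_subset by auto
    have "T U (L V) es = avg (edges_on K U) (\<lambda>e. ln (A * Z V es) + ln (1 - t e))"
      unfolding T_def using edges_on_mono[OF that(1), of K] by (intro avg_cong Leq) auto
    thus ?thesis using \<open>finite U\<close> that by (simp add: avg_add avg_const edges_on_nonempty)
  qed
  \<comment> \<open>The term at \<open>k = 0\<close> is a division by zero and therefore 0, as the
    series requires.\<close>
  have ser: "(\<lambda>k. avg (edges_on K U) (\<lambda>e. - (t e ^ k) / real k)) sums avg (edges_on K U) (\<lambda>e. ln (1 - t e))"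
    if "U \<subseteq> V" for U
  proof (rule sums_avg)
    fix e assume "e \<in> edges_on K U"
    hence "e \<in> edges_on K V" using edges_on_mono[OF that, of K] by auto
    thus "(\<lambda>k. - (t e ^ k) / real k) sums ln (1 - t e)"
      using ln_series'[of "- t e"] t0[of e] t1[of e] by simp
  qed
  have avgt: "avg Y (\<lambda>e. - (t e ^ k) / real k) = - (B ^ k / real k) * avg Y (\<lambda>e. f e ^ k)" for Y k
    unfolding avg_cmult[symmetric] by (intro avg_cong) (simp add: t_def power_mult_distrib)
  \<comment> \<open>All coefficients of the series of \<open>ln (1 - t)\<close> are nonpositive, so
    the upper bound for the moments on \<open>V\<close> turns into a lower bound for the logarithm,
    term by term.\<close>
  have le: "(\<Sum>b\<in>blk ` V. share V blk b * avg (edges_on K (?B b)) (\<lambda>e. ln (1 - t e)))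
      \<le> avg (edges_on K V) (\<lambda>e. ln (1 - t e))"
  proof (rule sums_le)
    show "(\<lambda>k. \<Sum>b\<in>blk ` V. share V blk b * avg (edges_on K (?B b)) (\<lambda>e. - (t e ^ k) / real k))
       sums (\<Sum>b\<in>blk ` V. share V blk b * avg (edges_on K (?B b)) (\<lambda>e. ln (1 - t e)))"
      by (intro sums_sum sums_mult ser) auto
    show "(\<lambda>k. avg (edges_on K V) (\<lambda>e. - (t e ^ k) / real k)) sums avg (edges_on K V) (\<lambda>e. ln (1 - t e))"
      by (rule ser) simp
    fix k
    have "avg (edges_on K V) (\<lambda>e. f e ^ k)
      \<le> (\<Sum>b\<in>blk ` V. share V blk b * avg (edges_on K (?B b)) (\<lambda>e. f e ^ k))"
      unfolding f_def share_def
      by (rule avg_edges_power_le_blocks) (use V finX finite_S \<mu>0 g_nonneg in auto)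
    hence "(B ^ k / real k) * avg (edges_on K V) (\<lambda>e. f e ^ k)
      \<le> (B ^ k / real k) * (\<Sum>b\<in>blk ` V. share V blk b * avg (edges_on K (?B b)) (\<lambda>e. f e ^ k))"
      using B_nonneg by (intro mult_left_mono) auto
    thus "(\<Sum>b\<in>blk ` V. share V blk b * avg (edges_on K (?B b)) (\<lambda>e. - (t e ^ k) / real k))
       \<le> avg (edges_on K V) (\<lambda>e. - (t e ^ k) / real k)"
      unfolding avgt by (simp add: sum_distrib_left sum_negf mult_ac)
  qed
  have "TS V blk (L V) es = (\<Sum>b\<in>blk ` V. share V blk b * (ln (A * Z V es) + avg (edges_on K (?B b)) (\<lambda>e. ln (1 - t e))))"
    unfolding TS_def by (intro sum.cong refl arg_cong2[where f = "(*)"] TL) auto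
  also have "\<dots> = ln (A * Z V es) + (\<Sum>b\<in>blk ` V. share V blk b * avg (edges_on K (?B b)) (\<lambda>e. ln (1 - t e)))"
    using sum_share[OF V, of blk] by (simp add: distrib_left sum.distrib sum_distrib_right[symmetric])
  also have "\<dots> \<le> T V (L V) es"
    using le TL[of V] V by simp
  finally show ?thesis .
qed

text \<open>One confined edge is taken as the innermost operator, where it acts on
  \<open>L V\<close> itself and the comparison for one edge applies. The resulting
  \<open>T V\<close> commutes to the outside, and the induction hypothesis is used beneath
  it.\<close>

lemma TS_pow_L_le:
  assumes V: "finite V" "V \<noteq> {}" and es: "adm V es"
  shows "(TS V blk ^^ M) (L V) es \<le> (T V ^^ M) (L V) es"
  using es
proof (induction M arbitrary: es)
  case (Suc M)
  have "(TS V blk ^^ Suc M) (L V) es = (TS V blk ^^ M) (TS V blk (L V)) es"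
    by (simp add: funpow_swap1)
  also have "\<dots> \<le> (TS V blk ^^ M) (T V (L V)) es"
    using Suc.prems by (intro TS_pow_mono TS_L_le_T_L V)
  also have "\<dots> = T V ((TS V blk ^^ M) (L V)) es"
    by (simp add: T_TS_pow_commute)
  also have "\<dots> \<le> T V ((T V ^^ M) (L V)) es"
    using Suc by (intro T_mono[of V]) auto
  finally show ?case by simp
qed simp

end

section \<open>Factorisation of the partition function over blocks\<close>

lemma sum_PiE_blocks:
  fixes \<psi> :: "'b \<Rightarrow> ('a \<Rightarrow> 'c) \<Rightarrow> real" and blk :: "'a \<Rightarrow> 'b"
  assumes "finite V" "finite Q"
  shows "(\<Sum>x\<in>V \<rightarrow>\<^sub>E Q. \<Prod>b\<in>blk ` V. \<psi> b (restrict x {i\<in>V. blk i = b}))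
       = (\<Prod>b\<in>blk ` V. \<Sum>y\<in>{i\<in>V. blk i = b} \<rightarrow>\<^sub>E Q. \<psi> b y)"
proof -
  let ?B = "\<lambda>b. {i\<in>V. blk i = b}"
  have "(\<Prod>b\<in>blk ` V. \<Sum>y\<in>?B b \<rightarrow>\<^sub>E Q. \<psi> b y)
      = (\<Sum>\<sigma>\<in>(\<Pi>\<^sub>E b\<in>blk ` V. ?B b \<rightarrow>\<^sub>E Q). \<Prod>b\<in>blk ` V. \<psi> b (\<sigma> b))"
    using assms by (intro prod_sum_PiE) (auto intro!: finite_PiE)
  also have "\<dots> = (\<Sum>x\<in>V \<rightarrow>\<^sub>E Q. \<Prod>b\<in>blk ` V. \<psi> b (restrict x (?B b)))"
  \<comment> \<open>Restricting to the blocks and gluing along \<open>blk\<close> are inverse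
    bijections.\<close>
  proof (rule sum.reindex_bij_witness[of _ "\<lambda>x. \<lambda>b\<in>blk ` V. restrict x (?B b)" "\<lambda>\<sigma>. \<lambda>i\<in>V. \<sigma> (blk i) i"])
    fix \<sigma> assume \<sigma>: "\<sigma> \<in> (\<Pi>\<^sub>E b\<in>blk ` V. ?B b \<rightarrow>\<^sub>E Q)"
    have "restrict (\<lambda>i\<in>V. \<sigma> (blk i) i) (?B b) = \<sigma> b" if "b \<in> blk ` V" for b
    proof -
      have "\<sigma> b \<in> ?B b \<rightarrow>\<^sub>E Q" using \<sigma> that by (rule PiE_mem)
      thus ?thesis by (intro ext) (auto simp: restrict_def PiE_iff extensional_def)
    qed
    note r = this
    show "(\<lambda>b\<in>blk ` V. restrict (\<lambda>i\<in>V. \<sigma> (blk i) i) (?B b)) = \<sigma>"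
    proof
      fix b
      show "(\<lambda>b\<in>blk ` V. restrict (\<lambda>i\<in>V. \<sigma> (blk i) i) (?B b)) b = \<sigma> b"
        by (cases "b \<in> blk ` V") (simp_all only: restrict_apply r PiE_arb[OF \<sigma>, symmetric] if_True if_False)
    qed
    show "(\<lambda>i\<in>V. \<sigma> (blk i) i) \<in> V \<rightarrow>\<^sub>E Q"
      using \<sigma> by (auto simp: PiE_iff)
    show "(\<Prod>b\<in>blk ` V. \<psi> b (restrict (\<lambda>i\<in>V. \<sigma> (blk i) i) (?B b))) = (\<Prod>b\<in>blk ` V. \<psi> b (\<sigma> b))"
      by (intro prod.cong refl) (simp only: r)
  next
    fix x assume x: "x \<in> V \<rightarrow>\<^sub>E Q"
    show "(\<lambda>i\<in>V. (\<lambda>b\<in>blk ` V. restrict x (?B b)) (blk i) i) = x"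
      using x by (intro ext) (auto simp: restrict_def PiE_iff extensional_def)
    show "(\<lambda>b\<in>blk ` V. restrict x (?B b)) \<in> (\<Pi>\<^sub>E b\<in>blk ` V. ?B b \<rightarrow>\<^sub>E Q)"
      using x by (auto simp: PiE_iff)
  qed
  finally show ?thesis by simp
qed

context interpolation
begin

definition block_edges where
  "block_edges V blk b es = filter_mset (\<lambda>e. e \<in> edges_on K {i\<in>V. blk i = b}) es"

abbreviation "blocked V blk es \<equiv> \<forall>e\<in>#es. \<exists>b\<in>blk ` V. e \<in> edges_on K {i\<in>V. blk i = b}"

text \<open>As \<open>K > 0\<close>, the endpoint in position 0 determines the block, so a confined
  edge enters exactly one of them.\<close>

lemma block_edges_add:
  assumes "e \<in> edges_on K {i\<in>V. blk i = b'}"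
  shows "block_edges V blk b (add_mset e es) =
    (if b = b' then add_mset e (block_edges V blk b es) else block_edges V blk b es)"
proof -
  have "e \<notin> edges_on K {i\<in>V. blk i = b}" if "b \<noteq> b'"
    using edges_on_disjoint[OF K_pos, of "{i\<in>V. blk i = b}" "{i\<in>V. blk i = b'}"] that assms by auto
  thus ?thesis using assms by (auto simp: block_edges_def)
qed

lemma adm_block_edges: "adm {i\<in>V. blk i = b} (block_edges V blk b es)"
  by (auto simp: block_edges_def)

lemma prod_mset_block_edges:
  fixes c :: "_ \<Rightarrow> real"
  assumes "finite V" "blocked V blk es"
  shows "(\<Prod>e\<in>#es. c e) = (\<Prod>b\<in>blk ` V. \<Prod>e\<in>#block_edges V blk b es. c e)"
  using assms(2)
proof (induction es)
  case empty
  then show ?case by (simp add: block_edges_def)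
next
  case (add e es)
  then obtain b' where b': "b' \<in> blk ` V" "e \<in> edges_on K {i\<in>V. blk i = b'}" by auto
  have "(\<Prod>b\<in>blk ` V. \<Prod>e\<in>#block_edges V blk b (add_mset e es). c e)
     = (\<Prod>b\<in>blk ` V. (if b = b' then c e else 1) * (\<Prod>e\<in>#block_edges V blk b es. c e))"
    by (intro prod.cong refl) (simp add: block_edges_add[OF b'(2)])
  also have "\<dots> = c e * (\<Prod>e\<in>#es. c e)"
    using add b' assms(1) by (simp add: prod.distrib)
  finally show ?case by simp
qed

text \<open>By \<open>w_eq\<close> a weight depends only on the spins at the endpoints, which lie in
  \<open>U\<close>; the factor of a block can thus be evaluated on the restricted
  configuration.\<close>

lemma w_restrict:
  assumes "e \<in> edges_on K U" "x \<in> U \<rightarrow> {0..<q}"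
  shows "w e (restrict x U) = w e x"
proof -
  have "restrict x U \<in> U \<rightarrow> {0..<q}" using assms by auto
  moreover have "restrict x U (fst e j) = x (fst e j)" if "j < K" for j
    using assms(1) that by (auto simp: edges_on_def PiE_iff)
  ultimately show ?thesis using assms by (simp add: w_eq)
qed

lemma Z_blocks:
  assumes V: "finite V" and es: "blocked V blk es"
  shows "Z V es = (\<Prod>b\<in>blk ` V. Z {i\<in>V. blk i = b} (block_edges V blk b es))"
proof -
  let ?B = "\<lambda>b. {i\<in>V. blk i = b}"
  let ?\<psi> = "\<lambda>b y. (\<Prod>i\<in>?B b. h (y i)) * (\<Prod>e\<in>#block_edges V blk b es. w e y)"
  have "Z V es = (\<Sum>x\<in>V \<rightarrow>\<^sub>E {0..<q}. \<Prod>b\<in>blk ` V. ?\<psi> b (restrict x (?B b)))"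
    unfolding gibbs_Z_def
  proof (intro sum.cong refl)
    fix x assume x: "x \<in> V \<rightarrow>\<^sub>E {0..<q}"
    have "(\<Prod>e\<in>#block_edges V blk b es. w e (restrict x (?B b))) = (\<Prod>e\<in>#block_edges V blk b es. w e x)" for b
      using x by (intro arg_cong[where f = prod_mset] image_mset_cong w_restrict)
        (auto simp: block_edges_def PiE_iff)
    hence "(\<Prod>b\<in>blk ` V. ?\<psi> b (restrict x (?B b)))
        = (\<Prod>b\<in>blk ` V. (\<Prod>i\<in>?B b. h (x i)) * (\<Prod>e\<in>#block_edges V blk b es. w e x))"
      by simp
    also have "\<dots> = (\<Prod>i\<in>V. h (x i)) * (\<Prod>e\<in>#es. w e x)"
      unfolding prod.distrib prod_mset_block_edges[OF V es, symmetric]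
      by (simp add: prod.image_gen[OF V, of "\<lambda>i. h (x i)" blk])
    finally show "(\<Prod>i\<in>V. h (x i)) * (\<Prod>e\<in>#es. w e x) = (\<Prod>b\<in>blk ` V. ?\<psi> b (restrict x (?B b)))" ..
  qed
  also have "\<dots> = (\<Prod>b\<in>blk ` V. Z (?B b) (block_edges V blk b es))"
    unfolding gibbs_Z_def using V by (intro sum_PiE_blocks) auto
  finally show ?thesis .
qed

text \<open>With the edges of \<open>TS\<close>, a single block receives a new edge with probability \<open>p\<close> only.\<close>

definition SB where "SB p U F es = (1 - p) * F es + p * T U F es"

text \<open>\<open>L V\<close> is a sum over blocks and each confined edge alters one summand. By
  linearity only the law of the edges within each single block matters, so the dependence between
  the edge numbers of different blocks never has to be treated.\<close>

lemma TS_pow_L_blocks: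
  assumes V: "finite V" "V \<noteq> {}" and es: "blocked V blk es"
  shows "(TS V blk ^^ M) (L V) es =
    (\<Sum>b\<in>blk ` V. (SB (share V blk b) {i\<in>V. blk i = b} ^^ M) (L {i\<in>V. blk i = b}) (block_edges V blk b es))"
  using es
proof (induction M arbitrary: es)
  case 0
  have "Z {i\<in>V. blk i = b} (block_edges V blk b es) > 0" for b
    using V by (intro Z_pos adm_block_edges) auto
  hence "L V es = (\<Sum>b\<in>blk ` V. L {i\<in>V. blk i = b} (block_edges V blk b es))"
    unfolding L_def Z_blocks[OF V(1) 0] using V by (intro ln_prod) (simp_all add: order_less_imp_not_eq2)
  thus ?case by simp
next
  case (Suc M)
  let ?B = "\<lambda>b. {i\<in>V. blk i = b}"
  let ?r = "\<lambda>b. block_edges V blk b"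
  let ?I = "blk ` V"
  define G where "G b = (SB (share V blk b) (?B b) ^^ M) (L (?B b))" for b
  have finI: "finite ?I" using V by simp
  have T: "T (?B b') ((TS V blk ^^ M) (L V)) es
      = (\<Sum>b\<in>?I. G b (?r b es)) + (T (?B b') (G b') (?r b' es) - G b' (?r b' es))" if b': "b' \<in> ?I" for b'
  proof -
    have ne: "edges_on K (?B b') \<noteq> {}" "finite (edges_on K (?B b'))"
      using b' V by (auto intro!: edges_on_nonempty)
    have "T (?B b') ((TS V blk ^^ M) (L V)) es = avg (edges_on K (?B b'))
        (\<lambda>e. (\<Sum>b\<in>?I. G b (?r b es)) + (1 * G b' (add_mset e (?r b' es)) + (-1) * G b' (?r b' es)))"
      unfolding T_def
    proof (rule avg_cong)
      fix e assume e: "e \<in> edges_on K (?B b')"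
      have "(TS V blk ^^ M) (L V) (add_mset e es) = (\<Sum>b\<in>?I. G b (?r b (add_mset e es)))"
        unfolding G_def using Suc.prems e b' by (intro Suc.IH) auto
      also have "\<dots> = (\<Sum>b\<in>?I. G b (?r b es) +
            (if b = b' then G b' (add_mset e (?r b' es)) - G b' (?r b' es) else 0))"
        by (intro sum.cong refl) (simp add: block_edges_add[OF e])
      also have "\<dots> = (\<Sum>b\<in>?I. G b (?r b es)) + (1 * G b' (add_mset e (?r b' es)) + (-1) * G b' (?r b' es))"
        using finI b' by (simp add: sum.distrib)
      finally show "(TS V blk ^^ M) (L V) (add_mset e es) = \<dots>" .
    qed
    thus ?thesis using ne by (simp only: avg_add avg_lincomb avg_const T_def) (simp add: avg_const)
  qed
  have "(TS V blk ^^ Suc M) (L V) es = (\<Sum>b'\<in>?I. share V blk b' * T (?B b') ((TS V blk ^^ M) (L V)) es)"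
    by (simp add: TS_def)
  also have "\<dots> = (\<Sum>b'\<in>?I. share V blk b' *
      ((\<Sum>b\<in>?I. G b (?r b es)) + (T (?B b') (G b') (?r b' es) - G b' (?r b' es))))"
    by (intro sum.cong refl) (simp only: T)
  also have "\<dots> = (\<Sum>b\<in>?I. G b (?r b es)) +
      (\<Sum>b'\<in>?I. share V blk b' * (T (?B b') (G b') (?r b' es) - G b' (?r b' es)))"
    using sum_share[OF V, of blk] by (simp add: distrib_left sum.distrib sum_distrib_right[symmetric])
  also have "\<dots> = (\<Sum>b\<in>?I. SB (share V blk b) (?B b) (G b) (?r b es))"
    unfolding SB_def sum.distrib[symmetric] by (intro sum.cong refl) (simp add: algebra_simps)
  finally show ?case by (simp add: G_def)
qed

lemma SB_lincomb:
  "SB p U (\<lambda>es. \<alpha> * F es + \<beta> * G es) = (\<lambda>es. \<alpha> * SB p U F es + \<beta> * SB p U G es)"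
  by (rule ext) (simp add: SB_def T_lincomb algebra_simps)

lemma SB_pow_lincomb:
  "(SB p U ^^ M) (\<lambda>es. \<alpha> * F es + \<beta> * G es) = (\<lambda>es. \<alpha> * (SB p U ^^ M) F es + \<beta> * (SB p U ^^ M) G es)"
  by (induction M) (simp_all add: SB_lincomb)

text \<open>A Bernoulli step maps \<open>D\<^sup>2\<close> to \<open>(D + p)\<^sup>2 + p (1 - p)\<close>, so \<open>M\<close> steps
  produce the second moment of a binomial variable without any binomial sum.\<close>

lemma SB_pow_quadratic:
  assumes p: "0 \<le> p" "p \<le> 1"
    and F: "\<And>j. \<alpha> - \<gamma> * (real j - m0)\<^sup>2 \<le> (T U ^^ j) F es"
  shows "\<alpha> - \<gamma> * ((real j + real M * p - m0)\<^sup>2 + real M * p * (1 - p)) \<le> (SB p U ^^ M) ((T U ^^ j) F) es"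
proof (induction M arbitrary: j)
  case 0
  then show ?case using F by simp
next
  case (Suc M)
  have "SB p U ((T U ^^ j) F) = (\<lambda>es. (1 - p) * (T U ^^ j) F es + p * (T U ^^ Suc j) F es)"
    by (rule ext) (simp add: SB_def)
  hence eq: "(SB p U ^^ Suc M) ((T U ^^ j) F) es
     = (1 - p) * (SB p U ^^ M) ((T U ^^ j) F) es + p * (SB p U ^^ M) ((T U ^^ Suc j) F) es"
    by (simp only: funpow_Suc_right o_apply SB_pow_lincomb)
  have "\<alpha> - \<gamma> * ((real j + real (Suc M) * p - m0)\<^sup>2 + real (Suc M) * p * (1 - p))
     = (1 - p) * (\<alpha> - \<gamma> * ((real j + real M * p - m0)\<^sup>2 + real M * p * (1 - p)))
      + p * (\<alpha> - \<gamma> * ((real (Suc j) + real M * p - m0)\<^sup>2 + real M * p * (1 - p)))"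
    by (simp add: algebra_simps power2_eq_square)
  also have "\<dots> \<le> (1 - p) * (SB p U ^^ M) ((T U ^^ j) F) es + p * (SB p U ^^ M) ((T U ^^ Suc j) F) es"
    using p by (intro add_mono mult_left_mono Suc.IH) auto
  finally show ?case unfolding eq .
qed

section \<open>Invariance under relabelling of the vertices\<close>

definition relabel where "relabel \<pi> e = (restrict (\<pi> \<circ> fst e) {0..<K}, snd e)"

lemma bij_betw_relabel:
  assumes "bij_betw \<pi> U U'"
  shows "bij_betw (relabel \<pi>) (edges_on K U) (edges_on K U')"
proof (rule bij_betw_byWitness[where f' = "relabel (inv_into U \<pi>)"])
  show "\<forall>e\<in>edges_on K U. relabel (inv_into U \<pi>) (relabel \<pi> e) = e"
    using assms by (auto simp: relabel_def edges_on_def PiE_iff fun_eq_iff restrict_def extensional_def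
      bij_betw_inv_into_left)
  show "\<forall>e\<in>edges_on K U'. relabel \<pi> (relabel (inv_into U \<pi>) e) = e"
    using assms by (auto simp: relabel_def edges_on_def PiE_iff fun_eq_iff restrict_def extensional_def
      bij_betw_inv_into_right)
  show "relabel \<pi> ` edges_on K U \<subseteq> edges_on K U'"
    using assms by (auto simp: relabel_def edges_on_def PiE_iff dest: bij_betwE)
  show "relabel (inv_into U \<pi>) ` edges_on K U' \<subseteq> edges_on K U"
    using assms by (auto simp: relabel_def edges_on_def PiE_iff dest: bij_betwE[OF bij_betw_inv_into])
qed

lemma Z_relabel:
  assumes \<pi>: "bij_betw \<pi> U U'" and es: "adm U es"
  shows "Z U' (image_mset (relabel \<pi>) es) = Z U es"
  unfolding gibbs_Z_def
proof (rule sum.reindex_bij_witness[of _ "\<lambda>x. \<lambda>i\<in>U'. x (inv_into U \<pi> i)" "\<lambda>x. \<lambda>i\<in>U. x (\<pi> i)"])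
  fix x assume x: "x \<in> U' \<rightarrow>\<^sub>E {0..<q}"
  show "(\<lambda>i\<in>U'. (\<lambda>i\<in>U. x (\<pi> i)) (inv_into U \<pi> i)) = x"
    using x \<pi> bij_betwE[OF bij_betw_inv_into[OF \<pi>]]
    by (intro ext) (auto simp: restrict_def PiE_iff extensional_def bij_betw_inv_into_right)
  show "(\<lambda>i\<in>U. x (\<pi> i)) \<in> U \<rightarrow>\<^sub>E {0..<q}"
    using x bij_betwE[OF \<pi>] by (auto simp: PiE_iff)
  have "w (relabel \<pi> e) x = w e (\<lambda>i\<in>U. x (\<pi> i))" if e: "e \<in> edges_on K U" for e
  proof -
    have "relabel \<pi> e \<in> edges_on K U'" using bij_betwE[OF bij_betw_relabel[OF \<pi>]] e by auto
    moreover have "x \<in> U' \<rightarrow> {0..<q}" "(\<lambda>i\<in>U. x (\<pi> i)) \<in> U \<rightarrow> {0..<q}"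
      using x bij_betwE[OF \<pi>] by (auto simp: PiE_iff)
    moreover have "fst e j \<in> U" if "j < K" for j
      using e that by (auto simp: edges_on_def PiE_iff)
    ultimately show ?thesis using e by (simp add: w_eq relabel_def)
  qed
  hence "(\<Prod>e\<in>#es. w e (\<lambda>i\<in>U. x (\<pi> i))) = (\<Prod>e\<in>#image_mset (relabel \<pi>) es. w e x)"
    using es unfolding image_mset.compositionality o_def
    by (intro arg_cong[where f = prod_mset] image_mset_cong) auto
  moreover have "(\<Prod>i\<in>U. h ((\<lambda>i\<in>U. x (\<pi> i)) i)) = (\<Prod>i\<in>U'. h (x i))"
    using prod.reindex_bij_betw[OF \<pi>, of "\<lambda>i. h (x i)"] by simp
  ultimately show "(\<Prod>i\<in>U. h ((\<lambda>i\<in>U. x (\<pi> i)) i)) * (\<Prod>e\<in>#es. w e (\<lambda>i\<in>U. x (\<pi> i)))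
     = (\<Prod>i\<in>U'. h (x i)) * (\<Prod>e\<in>#image_mset (relabel \<pi>) es. w e x)" by simp
next
  fix x assume x: "x \<in> U \<rightarrow>\<^sub>E {0..<q}"
  show "(\<lambda>i\<in>U. (\<lambda>i\<in>U'. x (inv_into U \<pi> i)) (\<pi> i)) = x"
    using x \<pi> bij_betwE[OF \<pi>]
    by (intro ext) (auto simp: restrict_def PiE_iff extensional_def bij_betw_inv_into_left)
  show "(\<lambda>i\<in>U'. x (inv_into U \<pi> i)) \<in> U' \<rightarrow>\<^sub>E {0..<q}"
    using x bij_betwE[OF bij_betw_inv_into[OF \<pi>]] by (auto simp: PiE_iff)
qed

text \<open>A bijection carries uniform edges to uniform edges, so the expected logarithm depends on
  the number of vertices alone and a full block may be replaced by \<open>{1..n}\<close>.\<close>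

lemma T_pow_relabel:
  assumes \<pi>: "bij_betw \<pi> U U'" and es: "adm U es"
  shows "(T U' ^^ M) (L U') (image_mset (relabel \<pi>) es) = (T U ^^ M) (L U) es"
  using es
proof (induction M arbitrary: es)
  case 0
  then show ?case by (simp add: L_def Z_relabel[OF \<pi>])
next
  case (Suc M)
  define F where "F = (T U' ^^ M) (L U')"
  define G where "G = (T U ^^ M) (L U)"
  note b = bij_betw_relabel[OF \<pi>]
  have "(\<Sum>e\<in>edges_on K U'. F (add_mset e (image_mset (relabel \<pi>) es)))
      = (\<Sum>e\<in>edges_on K U. F (image_mset (relabel \<pi>) (add_mset e es)))"
    using sum.reindex_bij_betw[OF b, of "\<lambda>e. F (add_mset e (image_mset (relabel \<pi>) es))"] by simp
  also have "\<dots> = (\<Sum>e\<in>edges_on K U. G (add_mset e es))"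
    using Suc.prems by (intro sum.cong refl) (simp add: F_def G_def Suc.IH[symmetric])
  finally have "T U' F (image_mset (relabel \<pi>) es) = T U G es"
    using bij_betw_same_card[OF b] by (simp add: T_def avg_def)
  thus ?case by (simp add: F_def G_def)
qed

end

subsection \<open>Convergence and concentration\<close>

text \<open>The limit is the supremum of \<open>x n - \<delta> n\<close> over
  \<open>n \<ge> 1\<close>: an almost optimal \<open>n\<close> bounds \<open>x N\<close> from below
  for all large \<open>N\<close>, while \<open>x N - \<delta> N\<close> never exceeds the
  supremum.\<close>

lemma near_superadditive_limit:
  fixes x \<delta> :: "nat \<Rightarrow> real"
  assumes bdd: "\<And>n. x n \<le> b" and \<delta>: "\<delta> \<longlonglongrightarrow> 0" and \<delta>0: "\<And>n. \<delta> n \<ge> 0"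
    and step: "\<And>n \<epsilon>. n \<ge> 1 \<Longrightarrow> \<epsilon> > 0 \<Longrightarrow> eventually (\<lambda>N. x n - \<delta> n - \<epsilon> \<le> x N) sequentially"
  shows "\<exists>z. x \<longlonglongrightarrow> z"
proof -
  define Y where "Y = (\<lambda>n. x n - \<delta> n) ` {1..}"
  define z where "z = Sup Y"
  have "y \<le> b" if y: "y \<in> Y" for y
  proof -
    obtain n where "y = x n - \<delta> n" using y by (auto simp: Y_def)
    thus ?thesis using bdd[of n] \<delta>0[of n] by linarith
  qed
  hence bY: "bdd_above Y" by (rule bdd_aboveI)
  have neY: "Y \<noteq> {}" by (simp add: Y_def)
  have "x \<longlonglongrightarrow> z"
  proof (rule LIMSEQ_I)
    fix r :: real assume r: "r > 0"
    obtain y where "y \<in> Y" "y > z - r / 3"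
      using less_cSup_iff[OF neY bY, of "z - r / 3"] r by (auto simp: z_def)
    then obtain n where n: "n \<ge> 1" "x n - \<delta> n > z - r / 3" by (auto simp: Y_def)
    have ev1: "eventually (\<lambda>N. x n - \<delta> n - r / 3 \<le> x N) sequentially"
      using step n r by auto
    have ev2: "eventually (\<lambda>N. \<delta> N < r / 3) sequentially"
      using order_tendstoD(2)[OF \<delta>, of "r / 3"] r by simp
    have "eventually (\<lambda>N. norm (x N - z) < r) sequentially"
      using ev1 ev2 eventually_ge_at_top[of 1]
    proof eventually_elim
      case (elim N)
      have "x N - \<delta> N \<le> z" unfolding z_def using elim by (intro cSup_upper bY) (auto simp: Y_def)
      thus ?case using elim n(2) r by (simp add: abs_less_iff)
    qed
    thus "\<exists>N0. \<forall>N\<ge>N0. norm (x N - z) < r" by (simp add: eventually_sequentially)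
  qed
  thus ?thesis ..
qed

text \<open>Trades an absolute deviation for a second moment; \<open>s\<close> is later
  \<open>sqrt n\<close>, the order of the deviation itself.\<close>

lemma abs_le_quadratic:
  fixes d s :: real assumes "s > 0" shows "\<bar>d\<bar> \<le> s / 2 + d\<^sup>2 / (2 * s)"
proof -
  have "0 \<le> (\<bar>d\<bar> - s)\<^sup>2" by simp
  hence "2 * s * \<bar>d\<bar> \<le> s\<^sup>2 + d\<^sup>2" by (simp add: power2_diff mult_ac add_ac)
  thus ?thesis using assms by (simp add: field_simps power2_eq_square)
qed

lemma tendsto_nat_floor_mult:
  assumes "c \<ge> 0" shows "(\<lambda>N. real (nat \<lfloor>c * real N\<rfloor>) / real N) \<longlonglongrightarrow> c"
proof (rule tendsto_sandwich)
  show "eventually (\<lambda>N. c - 1 / real N \<le> real (nat \<lfloor>c * real N\<rfloor>) / real N) sequentially"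
    using eventually_gt_at_top[of 0]
  proof eventually_elim
    case (elim N)
    have "(c * real N - 1) / real N \<le> real (nat \<lfloor>c * real N\<rfloor>) / real N"
      using assms by (intro divide_right_mono) linarith+
    thus ?case using elim by (simp add: diff_divide_distrib)
  qed
  show "eventually (\<lambda>N. real (nat \<lfloor>c * real N\<rfloor>) / real N \<le> c) sequentially"
    using eventually_gt_at_top[of 0]
  proof eventually_elim
    case (elim N)
    have "real (nat \<lfloor>c * real N\<rfloor>) \<le> c * real N" using assms by simp
    thus ?case using elim by (simp add: field_simps)
  qed
  show "(\<lambda>N. c - 1 / real N) \<longlonglongrightarrow> c" using tendsto_diff[OF tendsto_const lim_1_over_n] by simp
qed simp

lemma tendsto_div_nat:
  assumes "n \<ge> 1" shows "(\<lambda>N. real (N div n) / real N) \<longlonglongrightarrow> 1 / real n"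
proof (rule tendsto_sandwich)
  have *: "real (N div n) * real n \<le> real N" "real N \<le> real (N div n) * real n + real n" for N
  proof -
    have "real N = real (N div n) * real n + real (N mod n)"
      unfolding of_nat_mult[symmetric] of_nat_add[symmetric] by (simp only: div_mult_mod_eq)
    moreover have "real (N mod n) \<le> real n" using assms by (simp add: less_imp_le)
    ultimately show "real (N div n) * real n \<le> real N" "real N \<le> real (N div n) * real n + real n"
      by simp_all
  qed
  show "eventually (\<lambda>N. 1 / real n - 1 / real N \<le> real (N div n) / real N) sequentially"
    using eventually_gt_at_top[of 0]
  proof eventually_elim
    case (elim N)
    have "(real N / real n - 1) / real N \<le> real (N div n) / real N"
      using *(2)[of N] assms by (intro divide_right_mono) (auto simp: field_simps)
    thus ?case using elim by (simp add: diff_divide_distrib)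
  qed
  show "eventually (\<lambda>N. real (N div n) / real N \<le> 1 / real n) sequentially"
    using eventually_gt_at_top[of 0]
  proof eventually_elim
    case (elim N)
    have "real (N div n) / real N \<le> (real N / real n) / real N"
      using *(1)[of N] assms by (intro divide_right_mono) (auto simp: field_simps)
    thus ?case using elim by simp
  qed
  show "(\<lambda>N. 1 / real n - 1 / real N) \<longlonglongrightarrow> 1 / real n"
    using tendsto_diff[OF tendsto_const lim_1_over_n] by simp
qed simp

text \<open>The variance is the least mean square deviation from a constant, hence at most the one
  from \<open>a\<close>.\<close>

lemma avg_power2_le:
  assumes X: "finite X" "X \<noteq> {}" and f: "\<And>x. x \<in> X \<Longrightarrow> \<bar>f x - a\<bar> \<le> C"
  shows "avg X (\<lambda>x. (f x)\<^sup>2) \<le> (avg X f)\<^sup>2 + C\<^sup>2"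
proof -
  have "avg X (\<lambda>x. (f x)\<^sup>2) = avg X (\<lambda>x. 1 * (f x - a)\<^sup>2 + 1 * (2 * a * f x + (- a\<^sup>2) * 1))"
    by (intro avg_cong) (simp add: power2_eq_square algebra_simps)
  also have "\<dots> = avg X (\<lambda>x. (f x - a)\<^sup>2) + (2 * a * avg X f - a\<^sup>2)"
    by (simp only: avg_lincomb avg_const[OF X]) simp
  also have "avg X (\<lambda>x. (f x - a)\<^sup>2) \<le> avg X (\<lambda>x. C\<^sup>2)"
    using f by (intro avg_mono) (auto simp: abs_le_square_iff[symmetric] intro: order_trans[OF _ abs_ge_self])
  also have "avg X (\<lambda>x. C\<^sup>2) = C\<^sup>2" by (rule avg_const[OF X])
  finally have "avg X (\<lambda>x. (f x)\<^sup>2) \<le> C\<^sup>2 + (2 * a * avg X f - a\<^sup>2)" by simp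
  moreover have "0 \<le> (avg X f - a)\<^sup>2" by simp
  ultimately show ?thesis by (simp add: power2_diff mult_ac)
qed

section \<open>Growth of the expected logarithm and existence of its limit\<close>

context interpolation
begin

lemma T_pow_mono:
  assumes "\<And>es. adm U es \<Longrightarrow> F es \<le> G es" "adm U es"
  shows "(T U ^^ M) F es \<le> (T U ^^ M) G es"
  using assms(2) by (induction M arbitrary: es) (auto intro!: assms T_mono[of U])

lemma T_add_const:
  assumes "finite U" "U \<noteq> {}"
  shows "T U (\<lambda>es. F es + k) = (\<lambda>es. T U F es + k)"
  using assms by (intro ext) (simp add: T_def avg_add avg_const edges_on_nonempty)

lemma T_pow_add_const:
  assumes "finite U" "U \<noteq> {}"
  shows "(T U ^^ M) (\<lambda>es. F es + k) = (\<lambda>es. (T U ^^ M) F es + k)"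
  by (induction M) (simp_all add: T_add_const[OF assms])

definition mean_log_Z where "mean_log_Z U j = (T U ^^ j) (L U) {#}"

definition C where "C = max \<bar>ln c0\<bar> \<bar>ln A\<bar>"

lemma C_nonneg: "C \<ge> 0" by (simp add: C_def)

lemma mean_log_Z_Suc_bounds:
  assumes U: "finite U" "U \<noteq> {}"
  shows "mean_log_Z U j + ln c0 \<le> mean_log_Z U (Suc j)" "mean_log_Z U (Suc j) \<le> mean_log_Z U j + ln A"
proof -
  have ne: "finite (edges_on K U)" "edges_on K U \<noteq> {}"
    using U by (auto intro!: edges_on_nonempty)
  \<comment> \<open>The additional edge is placed innermost, where the pointwise bounds for one edge
    apply.\<close>
  have eq: "mean_log_Z U (Suc j) = (T U ^^ j) (T U (L U)) {#}"
    by (simp add: mean_log_Z_def funpow_swap1)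
  have "L U es + ln c0 \<le> T U (L U) es" if "adm U es" for es
    using L_add_bounds(1)[OF U(1) that] avg_mono[of "edges_on K U" "\<lambda>_. L U es + ln c0"]
    by (simp add: T_def avg_const[OF ne])
  hence "(T U ^^ j) (\<lambda>es. L U es + ln c0) {#} \<le> (T U ^^ j) (T U (L U)) {#}"
    by (intro T_pow_mono) auto
  thus "mean_log_Z U j + ln c0 \<le> mean_log_Z U (Suc j)" unfolding eq by (simp add: T_pow_add_const[OF U] mean_log_Z_def)
  have "T U (L U) es \<le> L U es + ln A" if "adm U es" for es
    using L_add_bounds(2)[OF U(1) that] avg_mono[of "edges_on K U" _ "\<lambda>_. L U es + ln A"]
    by (simp add: T_def avg_const[OF ne])
  hence "(T U ^^ j) (T U (L U)) {#} \<le> (T U ^^ j) (\<lambda>es. L U es + ln A) {#}"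
    by (intro T_pow_mono) auto
  thus "mean_log_Z U (Suc j) \<le> mean_log_Z U j + ln A" unfolding eq by (simp add: T_pow_add_const[OF U] mean_log_Z_def)
qed

lemma mean_log_Z_bounds:
  assumes U: "finite U" "U \<noteq> {}" and "j \<le> k"
  shows "mean_log_Z U j + (real k - real j) * ln c0 \<le> mean_log_Z U k" "mean_log_Z U k \<le> mean_log_Z U j + (real k - real j) * ln A"
proof -
  have "mean_log_Z U j + (real k - real j) * ln c0 \<le> mean_log_Z U k \<and> mean_log_Z U k \<le> mean_log_Z U j + (real k - real j) * ln A"
    using \<open>j \<le> k\<close>
  proof (induction k rule: dec_induct)
    case (step k)
    thus ?case using mean_log_Z_Suc_bounds[OF U, of k] by (simp add: algebra_simps)
  qed simp
  thus "mean_log_Z U j + (real k - real j) * ln c0 \<le> mean_log_Z U k" "mean_log_Z U k \<le> mean_log_Z U j + (real k - real j) * ln A"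
    by auto
qed

lemma mean_log_Z_lipschitz:
  assumes U: "finite U" "U \<noteq> {}"
  shows "\<bar>mean_log_Z U k - mean_log_Z U j\<bar> \<le> C * \<bar>real k - real j\<bar>"
proof -
  have *: "\<bar>mean_log_Z U k - mean_log_Z U j\<bar> \<le> C * (real k - real j)" if "j \<le> k" for j k
  proof -
    have "(real k - real j) * (- C) \<le> (real k - real j) * ln c0"
      using that by (intro mult_left_mono) (auto simp: C_def)
    moreover have "(real k - real j) * ln A \<le> (real k - real j) * C"
      using that by (intro mult_left_mono) (auto simp: C_def)
    ultimately show ?thesis using mean_log_Z_bounds[OF U that] by (simp add: abs_le_iff algebra_simps)
  qed
  show ?thesis using *[of j k] *[of k j] by (cases "j \<le> k") (auto simp: abs_minus_commute)
qed

definition H where "H = (\<Sum>s\<in>{0..<q}. h s)"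

lemma mean_log_Z_0:
  assumes "finite U" shows "mean_log_Z U 0 = real (card U) * ln H"
proof -
  have "H > 0" unfolding H_def using q_pos by (intro sum_pos h_pos) auto
  moreover have "Z U {#} = H ^ card U"
    unfolding gibbs_Z_def H_def
    using prod_sum_PiE[of U "\<lambda>_. {0..<q}" "\<lambda>_. h"] assms by simp
  ultimately show ?thesis by (simp add: mean_log_Z_def L_def ln_realpow)
qed

lemma mean_log_Z_card_cong:
  assumes "finite U" "finite U'" "card U = card U'"
  shows "mean_log_Z U j = mean_log_Z U' j"
proof -
  obtain \<pi> where "bij_betw \<pi> U U'" using finite_same_card_bij assms by blast
  from T_pow_relabel[OF this, of "{#}" j] show ?thesis by (simp add: mean_log_Z_def)
qed

text \<open>The number of edges in the block is binomial with mean \<open>M * p\<close>. Replacing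
  it by the fixed number \<open>m0\<close> costs at most \<open>C\<close> times the deviation, and
  dominating this by a quadratic leaves only a second moment to compute.\<close>

lemma SB_pow_L_lower:
  assumes U: "finite U" "U \<noteq> {}" and p: "0 \<le> p" "p \<le> 1" and s: "s > 0"
  shows "mean_log_Z U m0 - C * (s / 2) - C / (2 * s) * ((real M * p - real m0)\<^sup>2 + real M * p * (1 - p))
     \<le> (SB p U ^^ M) (L U) {#}"
proof -
  have "mean_log_Z U m0 - C * (s / 2) - C / (2 * s) * (real j - real m0)\<^sup>2 \<le> (T U ^^ j) (L U) {#}" for j
  proof -
    have "C * \<bar>real j - real m0\<bar> \<le> C * (s / 2 + (real j - real m0)\<^sup>2 / (2 * s))"
      by (intro mult_left_mono abs_le_quadratic s C_nonneg)
    thus ?thesis using mean_log_Z_lipschitz[OF U, of j m0] unfolding mean_log_Z_def by (simp add: algebra_simps abs_le_iff)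
  qed
  from SB_pow_quadratic[OF p this, of 0 M] show ?thesis by simp
qed

text \<open>Meant for the incomplete block, whose size has no useful lower bound. It is compared
  with the edgeless block, and \<open>j \<le> j\<^sup>2\<close> makes the quadratic estimate
  applicable.\<close>

lemma SB_pow_L_crude:
  assumes U: "finite U" "U \<noteq> {}" and p: "0 \<le> p" "p \<le> 1"
  shows "- real (card U) * \<bar>ln H\<bar> - C * ((real M * p)\<^sup>2 + real M * p) \<le> (SB p U ^^ M) (L U) {#}"
proof -
  have "mean_log_Z U 0 - C * (real j - 0)\<^sup>2 \<le> (T U ^^ j) (L U) {#}" for j
  proof -
    have "C * real j \<le> C * (real j)\<^sup>2"
      by (intro mult_left_mono C_nonneg) (cases j, auto simp: power2_eq_square)
    thus ?thesis using mean_log_Z_lipschitz[OF U, of j 0] unfolding mean_log_Z_def by (simp add: abs_le_iff)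
  qed
  from SB_pow_quadratic[OF p this, of 0 M]
  have "mean_log_Z U 0 - C * ((real M * p)\<^sup>2 + real M * p * (1 - p)) \<le> (SB p U ^^ M) (L U) {#}" by simp
  moreover have "real M * p * (1 - p) \<le> real M * p * 1"
    using p by (intro mult_left_mono) auto
  hence "C * ((real M * p)\<^sup>2 + real M * p * (1 - p)) \<le> C * ((real M * p)\<^sup>2 + real M * p)"
    using C_nonneg by (intro mult_left_mono) auto
  moreover have "real (card U) * (- \<bar>ln H\<bar>) \<le> real (card U) * ln H"
    by (intro mult_left_mono) auto
  ultimately show ?thesis by (simp add: mean_log_Z_0[OF U(1)])
qed

text \<open>A full block has share \<open>n / N\<close>; its mean number of edges differs from the
  floor of \<open>c * n\<close> by at most 1 and the variance is at most \<open>c * n\<close>, which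
  gives \<open>1 + c * real n\<close>. The choice \<open>s = sqrt n\<close> makes both errors of
  order \<open>sqrt n\<close>. The last bracket pays for the incomplete block.\<close>

lemma mean_log_Z_near_superadditive:
  assumes n: "1 \<le> n" "n \<le> N" and c: "c \<ge> 0"
  shows "real (N div n) * (mean_log_Z {1..n} (nat \<lfloor>c * real n\<rfloor>) - C * (sqrt n / 2) - C / (2 * sqrt n) * (1 + c * real n))
       - (real n * \<bar>ln H\<bar> + C * ((c * real n)\<^sup>2 + c * real n))
     \<le> mean_log_Z {1..N} (nat \<lfloor>c * real N\<rfloor>)"
proof -
  define V where "V = {1..N}"
  \<comment> \<open>Vertices are numbered from 1, hence the shift: block \<open>b\<close> is
    \<open>{b * n + 1..b * n + n}\<close> cut off at \<open>N\<close>.\<close>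
  define blk where "blk i = (i - 1) div n" for i :: nat
  define M where "M = nat \<lfloor>c * real N\<rfloor>"
  define m0 where "m0 = nat \<lfloor>c * real n\<rfloor>"
  let ?B = "\<lambda>b. {i\<in>V. blk i = b}"
  let ?p = "share V blk"
  let ?I = "blk ` V"
  define t where "t b = (SB (?p b) (?B b) ^^ M) (L (?B b)) {#}" for b
  define X where "X = mean_log_Z {1..n} m0 - C * (sqrt n / 2) - C / (2 * sqrt n) * (1 + c * real n)"
  define D where "D = real n * \<bar>ln H\<bar> + C * ((c * real n)\<^sup>2 + c * real n)"
  have V: "finite V" "V \<noteq> {}" "card V = N" using n by (auto simp: V_def)
  have Npos: "real N > 0" using n by auto
  have sub: "?B b \<subseteq> {b * n + 1..b * n + n}" for b
  proof
    fix i assume "i \<in> ?B b"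
    hence i: "i \<ge> 1" and b: "b = (i - 1) div n" by (auto simp: V_def blk_def)
    have "b * n \<le> i - 1" "i - 1 < b * n + n"
      using n div_mult_mod_eq[of "i - 1" n] mod_less_divisor[of n "i - 1"] unfolding b by linarith+
    thus "i \<in> {b * n + 1..b * n + n}" using i by auto
  qed
  have card_le: "card (?B b) \<le> n" for b
    using card_mono[OF _ sub[of b]] by simp
  have full: "card (?B b) = n" "b \<in> ?I" if "b < N div n" for b
  proof -
    have "(b + 1) * n \<le> N div n * n" using that by (intro mult_le_mono1) simp
    hence "(b + 1) * n \<le> N" using div_times_less_eq_dividend order_trans by blast
    hence "{b * n + 1..b * n + n} \<subseteq> ?B b"
      using n by (auto simp: V_def blk_def algebra_simps intro!: div_nat_eqI)
    hence "?B b = {b * n + 1..b * n + n}" using sub[of b] by blast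
    thus "card (?B b) = n" by simp
    hence "?B b \<noteq> {}" using n by (intro notI) simp
    thus "b \<in> ?I" by auto
  qed
  have ne: "finite (?B b)" "b \<in> ?I \<Longrightarrow> ?B b \<noteq> {}" for b using V by auto
  have p01: "0 \<le> ?p b" "?p b \<le> 1" for b
    using card_mono[OF V(1), of "?B b"] V Npos by (auto simp: share_def)
  have M: "real M \<le> c * real N" "c * real N - 1 \<le> real M"
    unfolding M_def using c by (simp, linarith)
  have Mp: "real M * ?p b \<le> c * real n" for b
  proof -
    have "real M * ?p b \<le> c * real N * (real n / real N)"
      unfolding share_def V using M card_le[of b] c
      by (intro mult_mono divide_right_mono) auto
    thus ?thesis using Npos by simp
  qed
  have Mp0: "0 \<le> real M * ?p b" for b using p01 by simp
  have crude: "- D \<le> t b" if "b \<in> ?I" for b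
  proof -
    have "real (card (?B b)) * \<bar>ln H\<bar> \<le> real n * \<bar>ln H\<bar>"
      using card_le[of b] by (intro mult_right_mono) auto
    moreover have "C * ((real M * ?p b)\<^sup>2 + real M * ?p b) \<le> C * ((c * real n)\<^sup>2 + c * real n)"
      using Mp Mp0 by (intro mult_left_mono add_mono power_mono C_nonneg) auto
    ultimately show ?thesis
      using SB_pow_L_crude[OF ne(1) ne(2)[OF that] p01, of M b] unfolding t_def D_def by linarith
  qed
  have good: "X \<le> t b" if b: "b < N div n" for b
  proof -
    have pb: "?p b = real n / real N" using full(1)[OF b] V by (simp add: share_def)
    have "real M * ?p b \<ge> c * real n - 1"
    proof -
      have "(c * real N - 1) * (real n / real N) \<le> real M * (real n / real N)"
        using M by (intro mult_right_mono) auto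
      moreover have "(c * real N - 1) * (real n / real N) = c * real n - real n / real N"
        using Npos by (simp add: field_simps)
      moreover have "real n / real N \<le> 1" using n Npos by simp
      ultimately show ?thesis unfolding pb by linarith
    qed
    moreover have "real m0 \<le> c * real n" "c * real n - 1 \<le> real m0"
      unfolding m0_def using c by (simp, linarith)
    ultimately have "\<bar>real M * ?p b - real m0\<bar> \<le> 1" using Mp[of b] by linarith
    hence "(real M * ?p b - real m0)\<^sup>2 \<le> 1" by (simp add: abs_square_le_1)
    moreover have "real M * ?p b * (1 - ?p b) \<le> real M * ?p b * 1"
      using p01[of b] by (intro mult_left_mono) auto
    ultimately have "(real M * ?p b - real m0)\<^sup>2 + real M * ?p b * (1 - ?p b) \<le> 1 + c * real n"
      using Mp[of b] by linarith
    hence "C / (2 * sqrt n) * ((real M * ?p b - real m0)\<^sup>2 + real M * ?p b * (1 - ?p b))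
        \<le> C / (2 * sqrt n) * (1 + c * real n)"
      using C_nonneg by (intro mult_left_mono) auto
    moreover have "mean_log_Z (?B b) m0 = mean_log_Z {1..n} m0"
      using full(1)[OF b] V by (intro mean_log_Z_card_cong) auto
    ultimately show ?thesis
      using SB_pow_L_lower[OF ne(1) ne(2)[OF full(2)[OF b]] p01, of "sqrt n" m0 M b] n
      unfolding t_def X_def by simp
  qed
  have D0: "D \<ge> 0" unfolding D_def using C_nonneg c by auto
  \<comment> \<open>Beyond the full blocks only the index \<open>N div n\<close> can occur; it is
    absent when \<open>n\<close> divides \<open>N\<close>.\<close>
  have Ik: "?I - {..<N div n} \<subseteq> {N div n}"
  proof
    fix b assume "b \<in> ?I - {..<N div n}"
    then obtain i where "i \<le> N" "b = (i - 1) div n" "\<not> b < N div n" by (auto simp: V_def blk_def)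
    moreover have "(i - 1) div n \<le> N div n" using \<open>i \<le> N\<close> by (intro div_le_mono) simp
    ultimately show "b \<in> {N div n}" by simp
  qed
  have "real (N div n) * X - D \<le> (\<Sum>b\<in>{..<N div n}. t b) + (\<Sum>b\<in>?I - {..<N div n}. t b)"
  proof -
    have "(\<Sum>b\<in>{..<N div n}. X) \<le> (\<Sum>b\<in>{..<N div n}. t b)"
      using good by (intro sum_mono) auto
    moreover have "- D \<le> (\<Sum>b\<in>?I - {..<N div n}. t b)"
    proof (cases "?I - {..<N div n} = {}")
      case True
      show ?thesis unfolding True using D0 by simp
    next
      case False
      hence eq: "?I - {..<N div n} = {N div n}" using Ik by (meson subset_singletonD)
      hence "N div n \<in> ?I" by blast
      from crude[OF this] show ?thesis unfolding eq by simp
    qed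
    ultimately show ?thesis by simp
  qed
  also have "\<dots> = (\<Sum>b\<in>?I. t b)"
  proof -
    have "{..<N div n} \<subseteq> ?I" using full(2) by blast
    from sum.subset_diff[OF this, of t] V show ?thesis by (simp add: add.commute)
  qed
  also have "\<dots> = (TS V blk ^^ M) (L V) {#}"
    using TS_pow_L_blocks[OF V(1,2), of "{#}" blk M] by (simp add: t_def block_edges_def)
  also have "\<dots> \<le> mean_log_Z V M"
    unfolding mean_log_Z_def using V by (intro TS_pow_L_le) auto
  finally show ?thesis by (simp add: X_def D_def V_def M_def m0_def)
qed

lemma mean_log_Z_limit_exists:
  assumes c: "c \<ge> 0"
  shows "\<exists>z. (\<lambda>N. mean_log_Z {1..N} (nat \<lfloor>c * real N\<rfloor>) / real N) \<longlonglongrightarrow> z"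
proof (rule near_superadditive_limit)
  let ?x = "\<lambda>N. mean_log_Z {1..N} (nat \<lfloor>c * real N\<rfloor>) / real N"
  \<comment> \<open>The error of one full block; divided by \<open>n\<close> it is of order
    \<open>1 / sqrt n\<close>.\<close>
  define e where "e n = C * (sqrt n / 2) + C / (2 * sqrt n) * (1 + c * real n)" for n :: nat
  show "?x N \<le> \<bar>ln H\<bar> + C * c" for N
  proof (cases "N = 0")
    case True
    then show ?thesis using C_nonneg c by simp
  next
    case False
    have "mean_log_Z {1..N} (nat \<lfloor>c * real N\<rfloor>) \<le> mean_log_Z {1..N} 0 + C * real (nat \<lfloor>c * real N\<rfloor>)"
      using mean_log_Z_lipschitz[of "{1..N}" "nat \<lfloor>c * real N\<rfloor>" 0] False by (auto simp: abs_le_iff)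
    also have "\<dots> \<le> real N * \<bar>ln H\<bar> + C * (c * real N)"
      using c C_nonneg by (intro add_mono) (auto simp: mean_log_Z_0 intro!: mult_left_mono)
    finally show ?thesis using False by (simp add: field_simps)
  qed
  show "e n / real n \<ge> 0" for n
    using C_nonneg c by (simp add: e_def)
  have "(\<lambda>n. C / 2 * inverse (sqrt (real n)) + C / 2 * inverse (sqrt (real n)) * (1 / real n)
       + C * c / 2 * inverse (sqrt (real n))) \<longlonglongrightarrow> C / 2 * 0 + C / 2 * 0 * 0 + C * c / 2 * 0"
    by (intro tendsto_add tendsto_mult tendsto_const lim_1_over_n tendsto_inverse_0_at_top
      filterlim_compose[OF sqrt_at_top filterlim_real_sequentially])
  moreover have "C / 2 * inverse (sqrt (real n)) + C / 2 * inverse (sqrt (real n)) * (1 / real n)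
       + C * c / 2 * inverse (sqrt (real n)) = e n / real n" for n
  proof (cases "n = 0")
    case False
    hence "sqrt (real n) / real n = inverse (sqrt (real n))"
      by (simp add: sqrt_divide_self_eq inverse_eq_divide)
    moreover have "e n / real n = C / 2 * (sqrt (real n) / real n)
        + C / 2 * inverse (sqrt (real n)) * (1 / real n) + C * c / 2 * inverse (sqrt (real n))"
      using False by (simp add: e_def field_simps)
    ultimately show ?thesis by simp
  qed simp
  ultimately show "(\<lambda>n. e n / real n) \<longlonglongrightarrow> 0" by simp
  fix n :: nat and \<epsilon> :: real assume n: "1 \<le> n" and \<epsilon>: "\<epsilon> > 0"
  define D where "D = real n * \<bar>ln H\<bar> + C * ((c * real n)\<^sup>2 + c * real n)"
  let ?y = "mean_log_Z {1..n} (nat \<lfloor>c * real n\<rfloor>) - e n"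
  have "(\<lambda>N. real (N div n) / real N * ?y - D * (1 / real N)) \<longlonglongrightarrow> 1 / real n * ?y - D * 0"
    by (intro tendsto_diff tendsto_mult tendsto_const tendsto_div_nat n lim_1_over_n)
  moreover have "1 / real n * ?y - D * 0 = ?x n - e n / real n"
    by (simp add: diff_divide_distrib)
  ultimately have "(\<lambda>N. real (N div n) / real N * ?y - D * (1 / real N)) \<longlonglongrightarrow> ?x n - e n / real n" by simp
  hence "eventually (\<lambda>N. ?x n - e n / real n - \<epsilon> < real (N div n) / real N * ?y - D * (1 / real N)) sequentially"
    by (rule order_tendstoD) (use \<epsilon> in simp)
  thus "eventually (\<lambda>N. ?x n - e n / real n - \<epsilon> \<le> ?x N) sequentially"
    using eventually_ge_at_top[of n]
  proof eventually_elim
    case (elim N)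
    have "(real (N div n) * ?y - D) / real N \<le> ?x N"
      using mean_log_Z_near_superadditive[OF n elim(2) c]
      by (intro divide_right_mono) (simp_all add: e_def D_def algebra_simps)
    moreover have "real (N div n) / real N * ?y - D * (1 / real N) = (real (N div n) * ?y - D) / real N"
      by (simp add: diff_divide_distrib)
    ultimately show ?case using elim(1) by linarith
  qed
qed

section \<open>Variance of the logarithm by bounded differences\<close>

lemma T_pow_bounded_diff:
  assumes F: "\<And>es e. adm U es \<Longrightarrow> e \<in> edges_on K U \<Longrightarrow> \<bar>F (add_mset e es) - F es\<bar> \<le> D"
    and U: "finite U" "U \<noteq> {}" and "adm U es" "e \<in> edges_on K U"
  shows "\<bar>(T U ^^ M) F (add_mset e es) - (T U ^^ M) F es\<bar> \<le> D"
  using assms(4,5)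
proof (induction M arbitrary: es e)
  case 0
  then show ?case using F by simp
next
  case (Suc M)
  define G where "G = (T U ^^ M) F"
  let ?E = "edges_on K U"
  have ne: "finite ?E" "?E \<noteq> {}" using U by (auto intro!: edges_on_nonempty)
  \<comment> \<open>The same further edge \<open>e'\<close> is added on both sides, so averaging
    over it keeps the bound.\<close>
  have b: "\<bar>G (add_mset e' (add_mset e es)) - G (add_mset e' es)\<bar> \<le> D" if "e' \<in> ?E" for e'
    using Suc.IH[of "add_mset e' es" e] Suc.prems that by (simp add: G_def add_mset_commute)
  have "T U G (add_mset e es) - T U G es
      = avg ?E (\<lambda>e'. G (add_mset e' (add_mset e es)) - G (add_mset e' es))"
    by (simp add: T_def avg_diff)
  moreover have "\<dots> \<le> avg ?E (\<lambda>_. D)" using b by (intro avg_mono) (auto simp: abs_le_iff)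
  moreover have "avg ?E (\<lambda>_. - D) \<le> avg ?E (\<lambda>e'. G (add_mset e' (add_mset e es)) - G (add_mset e' es))"
    using b by (intro avg_mono) (fastforce simp: abs_le_iff)
  ultimately have "\<bar>T U G (add_mset e es) - T U G es\<bar> \<le> D" by (simp add: avg_const[OF ne] abs_le_iff)
  thus ?case by (simp add: G_def)
qed

text \<open>Edges are exposed one at a time: each moves the conditional expectation by at most
  \<open>D\<close>, and so contributes at most \<open>D\<^sup>2\<close> to the variance.\<close>

lemma T_pow_variance:
  assumes F: "\<And>es e. adm U es \<Longrightarrow> e \<in> edges_on K U \<Longrightarrow> \<bar>F (add_mset e es) - F es\<bar> \<le> D"
    and U: "finite U" "U \<noteq> {}" and "adm U es"
  shows "(T U ^^ M) (\<lambda>es. (F es)\<^sup>2) es \<le> ((T U ^^ M) F es)\<^sup>2 + real M * D\<^sup>2"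
  using assms(4)
proof (induction M arbitrary: es)
  case 0
  then show ?case by simp
next
  case (Suc M)
  define G where "G = (T U ^^ M) F"
  define G2 where "G2 = (T U ^^ M) (\<lambda>es. (F es)\<^sup>2)"
  let ?E = "edges_on K U"
  have ne: "finite ?E" "?E \<noteq> {}" using U by (auto intro!: edges_on_nonempty)
  have "T U G2 es \<le> avg ?E (\<lambda>e. (G (add_mset e es))\<^sup>2 + real M * D\<^sup>2)"
    unfolding T_def using Suc.IH Suc.prems by (intro avg_mono) (simp add: G_def G2_def)
  also have "\<dots> = avg ?E (\<lambda>e. (G (add_mset e es))\<^sup>2) + real M * D\<^sup>2"
    by (simp add: avg_add avg_const[OF ne])
  also have "avg ?E (\<lambda>e. (G (add_mset e es))\<^sup>2) \<le> (avg ?E (\<lambda>e. G (add_mset e es)))\<^sup>2 + D\<^sup>2"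
    using T_pow_bounded_diff[OF F U Suc.prems, of _ M]
    by (intro avg_power2_le[where a = "G es"] ne) (simp add: G_def)
  also have "avg ?E (\<lambda>e. G (add_mset e es)) = T U G es" by (simp add: T_def)
  finally have "T U G2 es \<le> (T U G es)\<^sup>2 + real (Suc M) * D\<^sup>2" by (simp add: algebra_simps)
  thus ?case by (simp add: G_def G2_def)
qed

lemma L_variance:
  assumes U: "finite U" "U \<noteq> {}"
  shows "(T U ^^ M) (\<lambda>es. (L U es - mean_log_Z U M)\<^sup>2) {#} \<le> real M * C\<^sup>2"
proof -
  let ?F = "\<lambda>es. L U es + (- mean_log_Z U M)"
  have "\<bar>?F (add_mset e es) - ?F es\<bar> \<le> C" if "adm U es" "e \<in> edges_on K U" for es e
    using L_add_bounds[OF U(1) that] by (auto simp: C_def abs_le_iff)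
  from T_pow_variance[OF this U, of "{#}" M]
  have "(T U ^^ M) (\<lambda>es. (?F es)\<^sup>2) {#} \<le> ((T U ^^ M) ?F {#})\<^sup>2 + real M * C\<^sup>2" by simp
  moreover have "(T U ^^ M) ?F {#} = 0"
    by (subst T_pow_add_const[OF U]) (simp add: mean_log_Z_def)
  ultimately show ?thesis by simp
qed

section \<open>The limit as a function of the edge density\<close>

definition z where "z c = lim (\<lambda>N. mean_log_Z {1..N} (nat \<lfloor>c * real N\<rfloor>) / real N)"

lemma z_limit: "c \<ge> 0 \<Longrightarrow> (\<lambda>N. mean_log_Z {1..N} (nat \<lfloor>c * real N\<rfloor>) / real N) \<longlonglongrightarrow> z c"
  unfolding z_def using mean_log_Z_limit_exists[of c] by (auto simp: limI)

text \<open>The bounds for the additional edges, divided by \<open>N\<close>, pass to the limit.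
  They yield the Lipschitz bound, and monotonicity when one of the two logarithms is 0.\<close>

lemma z_slope:
  assumes "0 \<le> c" "c \<le> c'"
  shows "(c' - c) * ln c0 \<le> z c' - z c" "z c' - z c \<le> (c' - c) * ln A"
proof -
  let ?j = "\<lambda>N. nat \<lfloor>c * real N\<rfloor>" and ?k = "\<lambda>N. nat \<lfloor>c' * real N\<rfloor>"
  have d: "(\<lambda>N. mean_log_Z {1..N} (?k N) / real N - mean_log_Z {1..N} (?j N) / real N) \<longlonglongrightarrow> z c' - z c"
    using assms by (intro tendsto_diff z_limit) auto
  have l: "(\<lambda>N. (real (?k N) / real N - real (?j N) / real N) * a) \<longlonglongrightarrow> (c' - c) * a" for a
    using assms by (intro tendsto_mult tendsto_diff tendsto_nat_floor_mult tendsto_const) auto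
  have jk: "?j N \<le> ?k N" for N using assms by (intro nat_mono floor_mono mult_right_mono) auto
  show "(c' - c) * ln c0 \<le> z c' - z c"
  proof (rule tendsto_le[OF _ d l])
    show "eventually (\<lambda>N. (real (?k N) / real N - real (?j N) / real N) * ln c0
       \<le> mean_log_Z {1..N} (?k N) / real N - mean_log_Z {1..N} (?j N) / real N) sequentially"
      using eventually_ge_at_top[of 1]
    proof eventually_elim
      case (elim N)
      have "(real (?k N) - real (?j N)) * ln c0 / real N \<le> (mean_log_Z {1..N} (?k N) - mean_log_Z {1..N} (?j N)) / real N"
        using mean_log_Z_bounds(1)[OF _ _ jk[of N], of "{1..N}"] elim by (intro divide_right_mono) auto
      thus ?case by (simp add: diff_divide_distrib left_diff_distrib)
    qed
  qed simp
  show "z c' - z c \<le> (c' - c) * ln A"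
  proof (rule tendsto_le[OF _ l d])
    show "eventually (\<lambda>N. mean_log_Z {1..N} (?k N) / real N - mean_log_Z {1..N} (?j N) / real N
       \<le> (real (?k N) / real N - real (?j N) / real N) * ln A) sequentially"
      using eventually_ge_at_top[of 1]
    proof eventually_elim
      case (elim N)
      have "(mean_log_Z {1..N} (?k N) - mean_log_Z {1..N} (?j N)) / real N \<le> (real (?k N) - real (?j N)) * ln A / real N"
        using mean_log_Z_bounds(2)[OF _ _ jk[of N], of "{1..N}"] elim by (intro divide_right_mono) auto
      thus ?case by (simp add: diff_divide_distrib left_diff_distrib)
    qed
  qed simp
qed

lemma z_lipschitz: "C-lipschitz_on {0<..} z"
proof (rule lipschitz_onI[OF _ C_nonneg])
  have *: "\<bar>z c' - z c\<bar> \<le> C * (c' - c)" if "0 < c" "c \<le> c'" for c c'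
  proof -
    have "(c' - c) * (- C) \<le> (c' - c) * ln c0"
      using that by (intro mult_left_mono) (auto simp: C_def)
    moreover have "(c' - c) * ln A \<le> (c' - c) * C"
      using that by (intro mult_left_mono) (auto simp: C_def)
    ultimately show ?thesis using z_slope[of c c'] that by (simp add: abs_le_iff algebra_simps)
  qed
  fix x y :: real assume "x \<in> {0<..}" "y \<in> {0<..}"
  thus "dist (z x) (z y) \<le> C * dist x y"
    using *[of x y] *[of y x] by (cases "x \<le> y") (auto simp: dist_real_def abs_minus_commute)
qed

end

section \<open>From counting instances to convergence in probability\<close>

lemma sum_PiE_insert:
  assumes "x \<notin> S"
  shows "(\<Sum>f\<in>insert x S \<rightarrow>\<^sub>E P. F f) = (\<Sum>y\<in>P. \<Sum>f\<in>S \<rightarrow>\<^sub>E P. F (f(x := y)))"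
  unfolding PiE_insert_eq
  by (subst sum.reindex[OF inj_combinator[OF assms]])
     (simp add: sum.cartesian_product case_prod_beta)

text \<open>Links uniform instances with iterated averages. The last index is split off as the edge
  drawn first; \<open>es\<close> holds the edges drawn already and so must be arbitrary in the
  induction.\<close>

lemma (in interpolation) sum_instances:
  assumes U: "finite U" "U \<noteq> {}"
  shows "(\<Sum>E\<in>{0..<M} \<rightarrow>\<^sub>E ({0..<K} \<rightarrow>\<^sub>E U). \<Sum>a\<in>{0..<M} \<rightarrow>\<^sub>E ({0..<K} \<rightarrow>\<^sub>E {0..<2}).
       \<Phi> (es + image_mset (\<lambda>t. (E t, a t)) (mset_set {0..<M})))
     = real (card (edges_on K U)) ^ M * (T U ^^ M) \<Phi> es"
proof (induction M arbitrary: es)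
  case 0
  then show ?case by simp
next
  case (Suc M)
  define G where "G = (T U ^^ M) \<Phi>"
  let ?P = "{0..<K} \<rightarrow>\<^sub>E U" and ?R = "{0..<K} \<rightarrow>\<^sub>E {0..<2::nat}"
  have ins: "{0..<Suc M} = insert M {0..<M}" by auto
  have upd: "image_mset (\<lambda>t. ((E(M := y)) t, (a(M := y')) t)) (mset_set {0..<M})
      = image_mset (\<lambda>t. (E t, a t)) (mset_set {0..<M})"
    for E :: "nat \<Rightarrow> nat \<Rightarrow> nat" and a :: "nat \<Rightarrow> nat \<Rightarrow> nat" and y y'
    by (intro image_mset_cong) auto
  have "(\<Sum>E\<in>{0..<Suc M} \<rightarrow>\<^sub>E ?P. \<Sum>a\<in>{0..<Suc M} \<rightarrow>\<^sub>E ?R.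
         \<Phi> (es + image_mset (\<lambda>t. (E t, a t)) (mset_set {0..<Suc M})))
     = (\<Sum>y\<in>?P. \<Sum>E\<in>{0..<M} \<rightarrow>\<^sub>E ?P. \<Sum>y'\<in>?R. \<Sum>a\<in>{0..<M} \<rightarrow>\<^sub>E ?R.
         \<Phi> (add_mset (y, y') es + image_mset (\<lambda>t. (E t, a t)) (mset_set {0..<M})))"
    unfolding ins by (simp add: sum_PiE_insert upd del: fun_upd_apply) (simp only: fun_upd_same)
  also have "\<dots> = (\<Sum>y\<in>?P. \<Sum>y'\<in>?R. \<Sum>E\<in>{0..<M} \<rightarrow>\<^sub>E ?P. \<Sum>a\<in>{0..<M} \<rightarrow>\<^sub>E ?R.
         \<Phi> (add_mset (y, y') es + image_mset (\<lambda>t. (E t, a t)) (mset_set {0..<M})))"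
    by (intro sum.cong refl sum.swap)
  also have "\<dots> = (\<Sum>y\<in>?P. \<Sum>y'\<in>?R. real (card (edges_on K U)) ^ M * G (add_mset (y, y') es))"
    unfolding G_def by (intro sum.cong refl Suc.IH)
  also have "\<dots> = real (card (edges_on K U)) ^ M * (\<Sum>e\<in>edges_on K U. G (add_mset e es))"
    by (simp add: edges_on_def sum.cartesian_product sum_distrib_left case_prod_beta)
  also have "\<dots> = real (card (edges_on K U)) ^ Suc M * T U G es"
    using U edges_on_nonempty[OF U(2), of K] by (simp add: T_def avg_def card_gt_0_iff)
  finally show ?case by (simp add: G_def)
qed

subsection \<open>The six models\<close>

definition node_weight :: "model \<Rightarrow> real \<Rightarrow> nat \<Rightarrow> real" where
  "node_weight m lam s = lam powr node_pot m s"

definition edge_weight :: "model \<Rightarrow> real \<Rightarrow> (nat \<Rightarrow> nat) \<times> (nat \<Rightarrow> nat) \<Rightarrow> (nat \<Rightarrow> nat) \<Rightarrow> real" where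
  "edge_weight m lam e x = lam_pow lam (edge_pot m (snd e) (\<lambda>j. x (fst e j)))"

lemma lam_pow_nonneg: "lam_pow lam r \<ge> 0"
  by (simp add: lam_pow_def)

lemma lam_pow_ereal: "lam_pow lam (ereal r) = lam powr r"
  by (simp add: lam_pow_def)

lemma lam_pow_add:
  assumes "r \<noteq> \<infinity>" "s \<noteq> \<infinity>"
  shows "lam_pow lam (r + s) = lam_pow lam r * lam_pow lam s"
  using assms by (cases r; cases s) (auto simp: lam_pow_def powr_add)

text \<open>The empty sum forces \<open>lam\<close> to be nonzero, since \<open>0 powr 0\<close> is
  0 and not 1.\<close>

lemma lam_pow_sum:
  assumes "finite I" "\<And>i. i \<in> I \<Longrightarrow> f i \<noteq> \<infinity>" "lam \<noteq> 0"
  shows "lam_pow lam (\<Sum>i\<in>I. f i) = (\<Prod>i\<in>I. lam_pow lam (f i))"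
  using assms(1,2)
proof (induction rule: finite_induct)
  case empty
  then show ?case using assms(3) by (simp add: lam_pow_def)
next
  case (insert i I)
  have "(\<Sum>i\<in>I. f i) \<noteq> \<infinity>" using insert by (auto simp: sum_Pinfty)
  thus ?case using insert by (simp add: lam_pow_add)
qed

lemma edge_pot_neq_infty: "edge_pot m a y \<noteq> \<infinity>"
  by (cases m) auto

lemma partition_fun_eq_gibbs_Z:
  assumes "lam \<noteq> 0"
  shows "partition_fun m lam N M E a =
    gibbs_Z (node_weight m lam) (alph m) (edge_weight m lam) {1..N} (image_mset (\<lambda>t. (E t, a t)) (mset_set {0..<M}))"
  unfolding partition_fun_def gibbs_Z_def configs_def
proof (intro sum.cong refl)
  fix x
  have s: "(\<Sum>i\<in>{1..N}. ereal (node_pot m (x i))) \<noteq> \<infinity>"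
    "(\<Sum>e\<in>{0..<M}. edge_pot m (a e) (\<lambda>j. x (E e j))) \<noteq> \<infinity>"
    by (auto simp: sum_Pinfty edge_pot_neq_infty)
  have "lam_pow lam (hamiltonian m N M E a x)
     = (\<Prod>i\<in>{1..N}. lam powr node_pot m (x i)) * (\<Prod>t\<in>{0..<M}. edge_weight m lam (E t, a t) x)"
    unfolding hamiltonian_def edge_weight_def lam_pow_add[OF s]
    by (simp add: lam_pow_sum edge_pot_neq_infty assms lam_pow_ereal del: sum_ereal)
  thus "lam_pow lam (hamiltonian m N M E a x) = (\<Prod>i\<in>{1..N}. node_weight m lam (x i)) *
      (\<Prod>e\<in>#image_mset (\<lambda>t. (E t, a t)) (mset_set {0..<M}). edge_weight m lam e x)"
    by (simp add: node_weight_def prod_unfold_prod_mset image_mset.compositionality o_def)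
qed

text \<open>This is Chebyshev's inequality: the variance is of order \<open>N\<close> and the
  deviation of order \<open>N\<close>, while the means already converge.\<close>

lemma free_energy_conv:
  assumes "interpolation (arity m) (alph m) (node_weight m lam) (edge_weight m lam) S g A B c0"
    and lam: "lam \<ge> 1" and c: "c \<ge> 0"
  shows "free_energy_conv_in_prob m lam c
    (interpolation.z (arity m) (alph m) (node_weight m lam) (edge_weight m lam) c)"
proof -
  interpret interpolation "arity m" "alph m" "node_weight m lam" "edge_weight m lam" S g A B c0 by fact
  show ?thesis unfolding free_energy_conv_in_prob_def
  proof (intro allI impI)
    fix \<epsilon> :: real assume \<epsilon>: "\<epsilon> > 0"
    define M where "M N = nat \<lfloor>c * real N\<rfloor>" for N
    define f where "f N E a = ln (partition_fun m lam N (M N) E a)" for N E a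
    let ?bad = "\<lambda>N. {(E, a). \<bar>f N E a / real N - z c\<bar> > \<epsilon>}"
    let ?P = "\<lambda>N. measure_pmf.prob (random_instance m N (M N)) (?bad N)"
    have fL: "f N E a = L {1..N} (image_mset (\<lambda>t. (E t, a t)) (mset_set {0..<M N}))" for N E a
      using lam by (simp add: f_def L_def partition_fun_eq_gibbs_Z)
    have bound: "?P N \<le> 4 * c * C\<^sup>2 / \<epsilon>\<^sup>2 * (1 / real N)"
      if N: "N \<ge> 1" and close: "\<bar>mean_log_Z {1..N} (M N) / real N - z c\<bar> < \<epsilon> / 2" for N
    proof -
      define \<Omega> where "\<Omega> = edge_space m N (M N) \<times> sign_space m (M N)"
      define \<mu> where "\<mu> = mean_log_Z {1..N} (M N)"
      \<comment> \<open>Once the mean is within \<open>\<epsilon> / 2\<close> of the limit, the bad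
        event forces a deviation of at least \<open>\<epsilon> * real N / 2\<close> from \<mu>;
        \<open>k\<close> is the inverse square of that.\<close>
      define k where "k = 4 / (\<epsilon> * real N)\<^sup>2"
      have U: "finite {1..N}" "{1..N} \<noteq> {}" using N by auto
      have fin: "finite \<Omega>" "\<Omega> \<noteq> {}"
        using N by (auto simp: \<Omega>_def edge_space_def sign_space_def PiE_eq_empty_iff intro!: finite_PiE)
      have card\<Omega>: "real (card \<Omega>) = real (card (edges_on (arity m) {1..N})) ^ M N"
        by (simp add: \<Omega>_def edge_space_def sign_space_def edges_on_def card_cartesian_product card_PiE
          power_mult_distrib)
      have k0: "k \<ge> 0" by (simp add: k_def)
      have ind: "indicator (?bad N) (E, a) \<le> k * (f N E a - \<mu>)\<^sup>2" for E a
      proof (cases "(E, a) \<in> ?bad N")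
        case True
        hence "\<epsilon> < \<bar>f N E a / real N - z c\<bar>" by simp
        hence "\<bar>f N E a / real N - \<mu> / real N\<bar> > \<epsilon> / 2" using close unfolding \<mu>_def by linarith
        moreover have "f N E a / real N - \<mu> / real N = (f N E a - \<mu>) / real N"
          by (simp add: diff_divide_distrib)
        ultimately have "\<epsilon> * real N / 2 \<le> \<bar>f N E a - \<mu>\<bar>"
          using N by (simp add: field_simps)
        hence "(\<epsilon> * real N / 2)\<^sup>2 \<le> (f N E a - \<mu>)\<^sup>2"
          using \<epsilon> by (metis abs_ge_zero abs_le_square_iff abs_of_nonneg divide_nonneg_nonneg
            mult_nonneg_nonneg less_imp_le of_nat_0_le_iff zero_le_numeral)
        hence "k * (\<epsilon> * real N / 2)\<^sup>2 \<le> k * (f N E a - \<mu>)\<^sup>2" using k0 by (rule mult_left_mono)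
        moreover have "k * (\<epsilon> * real N / 2)\<^sup>2 = 1"
          using \<epsilon> N by (simp add: k_def power_divide)
        ultimately show ?thesis using True by simp
      qed (simp add: k0)
      have "?P N = (\<Sum>\<omega>\<in>\<Omega>. indicator (?bad N) \<omega>) / real (card \<Omega>)"
      proof -
        have "?P N = measure_pmf.expectation (random_instance m N (M N)) (indicator (?bad N))" by simp
        also have "\<dots> = (\<Sum>\<omega>\<in>\<Omega>. indicator (?bad N) \<omega>) / real (card \<Omega>)"
          unfolding random_instance_def using fin
          by (subst integral_pmf_of_set) (simp_all add: \<Omega>_def)
        finally show ?thesis .
      qed
      also have "\<dots> \<le> (\<Sum>\<omega>\<in>\<Omega>. k * (f N (fst \<omega>) (snd \<omega>) - \<mu>)\<^sup>2) / real (card \<Omega>)"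
        using ind by (intro divide_right_mono sum_mono) auto
      also have "(\<Sum>\<omega>\<in>\<Omega>. k * (f N (fst \<omega>) (snd \<omega>) - \<mu>)\<^sup>2)
         = k * (\<Sum>E\<in>edge_space m N (M N). \<Sum>a\<in>sign_space m (M N). (f N E a - \<mu>)\<^sup>2)"
        by (simp add: \<Omega>_def sum.cartesian_product sum_distrib_left case_prod_beta)
      also have "(\<Sum>E\<in>edge_space m N (M N). \<Sum>a\<in>sign_space m (M N). (f N E a - \<mu>)\<^sup>2)
         = real (card \<Omega>) * (T {1..N} ^^ M N) (\<lambda>es. (L {1..N} es - \<mu>)\<^sup>2) {#}"
        unfolding card\<Omega>
        using sum_instances[OF U, where M = "M N" and \<Phi> = "\<lambda>es. (L {1..N} es - \<mu>)\<^sup>2" and es = "{#}"]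
        by (simp add: edge_space_def sign_space_def fL)
      also have "k * (real (card \<Omega>) * (T {1..N} ^^ M N) (\<lambda>es. (L {1..N} es - \<mu>)\<^sup>2) {#}) / real (card \<Omega>)
         = k * (T {1..N} ^^ M N) (\<lambda>es. (L {1..N} es - \<mu>)\<^sup>2) {#}"
        using fin by (simp add: card_gt_0_iff)
      also have "\<dots> \<le> k * (real (M N) * C\<^sup>2)"
        unfolding \<mu>_def by (intro mult_left_mono L_variance U k0)
      also have "\<dots> \<le> k * (c * real N * C\<^sup>2)"
        using c k0 by (intro mult_left_mono mult_right_mono) (auto simp: M_def)
      also have "\<dots> = 4 * c * C\<^sup>2 / \<epsilon>\<^sup>2 * (1 / real N)"
        using N \<epsilon> by (simp add: k_def field_simps power2_eq_square)
      finally show ?thesis .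
    qed
    have "?P \<longlonglongrightarrow> 0"
    proof (rule tendsto_sandwich[where f = "\<lambda>_. 0"])
      have "eventually (\<lambda>N. \<bar>mean_log_Z {1..N} (M N) / real N - z c\<bar> < \<epsilon> / 2) sequentially"
        using tendstoD[OF z_limit[OF c], of "\<epsilon> / 2"] \<epsilon> by (simp add: M_def dist_real_def)
      thus "eventually (\<lambda>N. ?P N \<le> 4 * c * C\<^sup>2 / \<epsilon>\<^sup>2 * (1 / real N)) sequentially"
        using eventually_ge_at_top[of 1] by eventually_elim (rule bound)
      show "(\<lambda>N. 4 * c * C\<^sup>2 / \<epsilon>\<^sup>2 * (1 / real N)) \<longlonglongrightarrow> 0"
        using tendsto_mult[OF tendsto_const[of "4 * c * C\<^sup>2 / \<epsilon>\<^sup>2"] lim_1_over_n]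
        by (simp only: mult_zero_right)
    qed simp_all
    thus "(\<lambda>N. measure_pmf.prob (random_instance m N (nat \<lfloor>c * real N\<rfloor>))
         {(E, a). \<bar>ln (partition_fun m lam N (nat \<lfloor>c * real N\<rfloor>) E a) / real N - z c\<bar> > \<epsilon>}) \<longlonglongrightarrow> 0"
      by (simp add: f_def M_def)
  qed
qed

text \<open>An edge has the lower weight iff, for one of the classes \<open>s\<close>, the spin at each endpoint
  matches \<open>s\<close> given the sign of the edge there; at most one class can match.\<close>

fun spin_classes :: "model \<Rightarrow> nat set" where
  "spin_classes MaxCut = {0..<2}"
| "spin_classes (Ising \<beta> b) = {0..<2}"
| "spin_classes (Coloring q) = {0..<q}"
| "spin_classes (NAESAT K) = {0, 1}"
| "spin_classes _ = {0}"

fun spin_match :: "model \<Rightarrow> nat \<Rightarrow> nat \<Rightarrow> nat \<Rightarrow> bool" where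
  "spin_match IndSet s b y \<longleftrightarrow> y = 1"
| "spin_match (KSAT K) s b y \<longleftrightarrow> y = b"
| "spin_match (NAESAT K) s b y \<longleftrightarrow> y = (if s = 0 then b else 1 - b)"
| "spin_match _ s b y \<longleftrightarrow> y = s"

fun weight_lo :: "model \<Rightarrow> real \<Rightarrow> real" where
  "weight_lo IndSet lam = 0"
| "weight_lo (Ising \<beta> b) lam = lam powr - \<beta>"
| "weight_lo _ lam = 1"

fun weight_hi :: "model \<Rightarrow> real \<Rightarrow> real" where
  "weight_hi IndSet lam = 1"
| "weight_hi (Ising \<beta> b) lam = lam powr \<beta>"
| "weight_hi _ lam = lam"

lemma prod_of_bool: "finite I \<Longrightarrow> (\<Prod>j\<in>I. of_bool (P j)) = (of_bool (\<forall>j\<in>I. P j) :: real)"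
  by (induction I rule: finite_induct) auto

lemma edge_pot_weight_eq:
  assumes "valid_model m" "lam \<ge> 1" "\<And>j. j < arity m \<Longrightarrow> y j < alph m"
  shows "lam_pow lam (edge_pot m a y) = weight_hi m lam * (1 - (1 - weight_lo m lam / weight_hi m lam) *
    (\<Sum>s\<in>spin_classes m. \<Prod>j\<in>{0..<arity m}. of_bool (spin_match m s (a j) (y j))))"
proof -
  have two: "(\<forall>j\<in>{0..<2::nat}. P j) \<longleftrightarrow> P 0 \<and> P 1" for P
    by (auto simp: less_2_cases_iff)
  have pair: "(\<Sum>s\<in>{0..<q}. of_bool (y 0 = s \<and> y 1 = s)) = (of_bool (y 0 = y 1) :: real)" if "y 0 < q" for q
  proof -
    have "(\<Sum>s\<in>{0..<q}. of_bool (y 0 = s \<and> y 1 = s)) = (\<Sum>s\<in>{0..<q}. if y 0 = s then of_bool (y 0 = y 1) else (0::real))"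
      by (intro sum.cong) auto
    thus ?thesis using that by simp
  qed
  have lam: "lam > 0" using assms by simp
  show ?thesis
  proof (cases m)
    case IndSet
    then show ?thesis using lam by (simp add: prod_of_bool two lam_pow_def)
  next
    case MaxCut
    then show ?thesis using assms(3)[of 0] lam pair[of 2] by (simp add: prod_of_bool two lam_pow_def)
  next
    case (Ising \<beta> b)
    then show ?thesis using assms(3)[of 0] lam pair[of 2]
      by (simp add: prod_of_bool two lam_pow_def)
  next
    case (Coloring q)
    then show ?thesis using assms(3)[of 0] lam pair[of q] by (simp add: prod_of_bool two lam_pow_def)
  next
    case (KSAT K)
    then show ?thesis using lam by (simp add: prod_of_bool lam_pow_def Ball_def)
  next
    case (NAESAT K)
    \<comment> \<open>Position 0 exists as \<open>K \<ge> 2\<close>, and \<open>a 0\<close> never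
      equals \<open>1 - a 0\<close>, even with truncated subtraction; so the two patterns of lower
      weight exclude each other.\<close>
    have "(\<forall>j<K. y j = a j) \<Longrightarrow> (\<forall>j<K. y j = Suc 0 - a j) \<Longrightarrow> False"
      using assms(1) NAESAT by (cases "a 0", auto dest!: spec[of _ 0])
    moreover have "(\<Sum>s\<in>{0, 1::nat}. \<Prod>j\<in>{0..<K}. of_bool (y j = (if s = 0 then a j else 1 - a j)))
        = of_bool (\<forall>j<K. y j = a j) + (of_bool (\<forall>j<K. y j = 1 - a j) :: real)"
      by (subst sum.insert) (simp_all add: prod_of_bool Ball_def)
    ultimately show ?thesis using NAESAT lam by (auto simp: lam_pow_def)
  qed
qed

lemma weight_lo_le_hi:
  assumes "valid_model m" "lam \<ge> 1"
  shows "weight_lo m lam \<le> weight_hi m lam" "weight_hi m lam > 0"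
  using assms by (cases m; auto intro!: powr_mono)+

text \<open>The comparison is made configuration by configuration, so it serves the models whose
  least edge weight is positive.\<close>

lemma gibbs_Z_add_ge:
  assumes "\<And>x e. x \<in> U \<rightarrow>\<^sub>E {0..<q} \<Longrightarrow> e \<in># es \<Longrightarrow> w e x \<ge> 0"
    and "\<And>s. h s \<ge> 0" and "\<And>x. x \<in> U \<rightarrow>\<^sub>E {0..<q} \<Longrightarrow> w e x \<ge> k"
  shows "k * gibbs_Z h q w U es \<le> gibbs_Z h q w U (add_mset e es)"
  unfolding gibbs_Z_def sum_distrib_left
proof (intro sum_mono)
  fix x assume x: "x \<in> U \<rightarrow>\<^sub>E {0..<q}"
  have "(\<Prod>e\<in>#es. w e x) \<ge> 0"
    using assms(1)[OF x] by (induction es) auto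
  hence "(\<Prod>i\<in>U. h (x i)) * (\<Prod>e\<in>#es. w e x) \<ge> 0"
    using assms(2) by (simp add: prod_nonneg)
  from mult_right_mono[OF assms(3)[OF x] this]
  show "k * ((\<Prod>i\<in>U. h (x i)) * (\<Prod>e\<in>#es. w e x)) \<le> (\<Prod>i\<in>U. h (x i)) * (\<Prod>e\<in>#add_mset e es. w e x)"
    by (simp add: mult_ac)
qed

text \<open>Emptying an endpoint of the new edge costs at most a factor \<open>lam\<close>, so independent sets
  avoiding that endpoint carry a fraction at least \<open>1 / (1 + lam)\<close> of the total weight.\<close>

lemma IndSet_gibbs_Z_add_ge:
  fixes lam :: real
  assumes lam: "lam \<ge> 1" and U: "finite U" and e: "e \<in> edges_on 2 U"
  defines "h \<equiv> node_weight IndSet lam" and "w \<equiv> edge_weight IndSet lam"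
  shows "1 / (1 + lam) * gibbs_Z h 2 w U es \<le> gibbs_Z h 2 w U (add_mset e es)"
proof -
  define i where "i = fst e 0"
  define X where "X = U \<rightarrow>\<^sub>E {0..<2::nat}"
  define X1 where "X1 = {x\<in>X. x i = 1}"
  define X0 where "X0 = {x\<in>X. x i \<noteq> 1}"
  define \<rho> where "\<rho> x = (\<Prod>i\<in>U. h (x i)) * (\<Prod>e\<in>#es. w e x)" for x
  have iU: "i \<in> U" using e by (auto simp: i_def edges_on_def PiE_iff)
  have finX: "finite X" using U by (simp add: X_def finite_PiE)
  have h: "h s = (if s = 1 then lam else 1)" for s
    using lam by (simp add: h_def node_weight_def)
  have w: "w e x = (if x (fst e 0) = 1 \<and> x (fst e 1) = 1 then 0 else 1)" for e x
    using lam by (simp add: w_def edge_weight_def lam_pow_def)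
  have wp: "(\<Prod>e\<in>#es. w e x) \<ge> 0" for x es by (induction es) (auto simp: w)
  have \<rho>0: "\<rho> x \<ge> 0" for x
    unfolding \<rho>_def using wp lam by (intro mult_nonneg_nonneg prod_nonneg) (auto simp: h)
  have \<rho>_le: "\<rho> x \<le> lam * \<rho> (x(i := 0))" if "x \<in> X1" for x
  proof -
    have mono: "w e' x \<le> w e' (x(i := 0))" "w e' (x(i := 0)) \<ge> 0" for e' by (auto simp: w)
    define x' where "x' = x(i := 0)"
    have "(\<Prod>e\<in>#es. w e x) \<le> (\<Prod>e\<in>#es. w e x')"
      by (induction es) (simp_all add: mult_mono[OF mono(1)[folded x'_def] _ mono(2)[folded x'_def] wp])
    moreover have "(\<Prod>j\<in>U. h (x j)) = lam * (\<Prod>j\<in>U. h ((x(i := 0)) j))"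
    proof -
      have "(\<Prod>j\<in>U - {i}. h ((x(i := 0)) j)) = (\<Prod>j\<in>U - {i}. h (x j))"
        by (intro prod.cong) auto
      thus ?thesis using U iU that
        by (simp add: prod.remove[of U i] h X1_def)
    qed
    moreover have "lam * (\<Prod>j\<in>U. h ((x(i := 0)) j)) \<ge> 0"
      using lam by (intro mult_nonneg_nonneg prod_nonneg) (auto simp: h)
    ultimately show ?thesis unfolding \<rho>_def
      unfolding x'_def by (metis mult.assoc mult_left_mono)
  qed
  have "(\<Sum>x\<in>X1. \<rho> x) \<le> (\<Sum>x\<in>X1. lam * \<rho> (x(i := 0)))"
    by (intro sum_mono \<rho>_le)
  also have "\<dots> = lam * (\<Sum>x\<in>(\<lambda>x. x(i := 0)) ` X1. \<rho> x)"
  proof -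
    \<comment> \<open>Every configuration in \<open>X1\<close> has the value 1 at \<open>i\<close>,
      so resetting it loses no information.\<close>
    have "inj_on (\<lambda>x. x(i := 0)) X1"
    proof (rule inj_onI)
      fix x y assume "x \<in> X1" "y \<in> X1" "x(i := 0) = y(i := 0)"
      thus "x = y" by (intro ext) (metis (mono_tags, lifting) X1_def fun_upd_apply mem_Collect_eq)
    qed
    thus ?thesis by (simp add: sum.reindex sum_distrib_left)
  qed
  also have "\<dots> \<le> lam * (\<Sum>x\<in>X0. \<rho> x)"
  proof -
    have "(\<lambda>x. x(i := 0)) ` X1 \<subseteq> X0"
      using iU by (auto simp: X0_def X1_def X_def PiE_iff extensional_def)
    moreover have "finite X0" using finX by (simp add: X0_def)
    ultimately show ?thesis using lam \<rho>0 by (intro mult_left_mono sum_mono2) auto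
  qed
  finally have X1_le: "(\<Sum>x\<in>X1. \<rho> x) \<le> lam * (\<Sum>x\<in>X0. \<rho> x)" .
  have "gibbs_Z h 2 w U es = (\<Sum>x\<in>X1 \<union> X0. \<rho> x)"
    unfolding gibbs_Z_def by (intro sum.cong) (auto simp: \<rho>_def X_def X1_def X0_def)
  also have "\<dots> = (\<Sum>x\<in>X1. \<rho> x) + (\<Sum>x\<in>X0. \<rho> x)"
    using finX by (intro sum.union_disjoint) (auto simp: X1_def X0_def)
  finally have Z: "gibbs_Z h 2 w U es \<le> (1 + lam) * (\<Sum>x\<in>X0. \<rho> x)"
    using X1_le by (simp add: algebra_simps)
  \<comment> \<open>An empty first endpoint satisfies the new edge, also when both endpoints
    coincide.\<close>
  have "(\<Sum>x\<in>X0. \<rho> x) = (\<Sum>x\<in>X0. \<rho> x * w e x)"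
    by (intro sum.cong) (auto simp: X0_def w i_def)
  also have "\<dots> \<le> (\<Sum>x\<in>X. \<rho> x * w e x)"
    using finX \<rho>0 by (intro sum_mono2) (auto simp: X0_def w)
  also have "\<dots> = gibbs_Z h 2 w U (add_mset e es)"
    by (simp add: gibbs_Z_def \<rho>_def X_def mult_ac)
  finally have "(1 + lam) * (\<Sum>x\<in>X0. \<rho> x) \<le> (1 + lam) * gibbs_Z h 2 w U (add_mset e es)"
    using lam by (intro mult_left_mono) auto
  with Z have "gibbs_Z h 2 w U es \<le> (1 + lam) * gibbs_Z h 2 w U (add_mset e es)" by linarith
  thus ?thesis using lam by (simp add: field_simps)
qed

definition weight_drop :: "model \<Rightarrow> real \<Rightarrow> real" where
  "weight_drop m lam = (if m = IndSet then 1 / (1 + lam) else weight_lo m lam)"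

text \<open>\<open>B\<close> is chosen so that a match turns the greater weight \<open>A\<close>
  into \<open>weight_lo m lam\<close>.\<close>

lemma interpolation_model:
  assumes m: "valid_model m" and lam: "lam \<ge> 1"
  shows "interpolation (arity m) (alph m) (node_weight m lam) (edge_weight m lam)
    (spin_classes m) (\<lambda>s b y. of_bool (spin_match m s b y))
    (weight_hi m lam) (1 - weight_lo m lam / weight_hi m lam) (weight_drop m lam)"
proof
  show "arity m > 0" "alph m > 0" using m by (cases m; simp)+
  show "finite (spin_classes m)" by (cases m) auto
  show "weight_hi m lam > 0" "1 - weight_lo m lam / weight_hi m lam \<ge> 0"
    using weight_lo_le_hi[OF m lam] by simp_all
  show "weight_drop m lam > 0" using m lam by (cases m) (auto simp: weight_drop_def)
  show "node_weight m lam s > 0" for s using lam by (simp add: node_weight_def)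
  show "edge_weight m lam e x \<ge> 0" for e x by (simp add: edge_weight_def lam_pow_nonneg)
  show "edge_weight m lam e x = weight_hi m lam * (1 - (1 - weight_lo m lam / weight_hi m lam) *
    (\<Sum>s\<in>spin_classes m. \<Prod>j\<in>{0..<arity m}. of_bool (spin_match m s (snd e j) (x (fst e j)))))"
    if e: "e \<in> edges_on (arity m) U" and x: "x \<in> U \<rightarrow> {0..<alph m}" for U e x
    unfolding edge_weight_def
  proof (rule edge_pot_weight_eq[OF m lam])
    fix j assume "j < arity m"
    hence "fst e j \<in> U" using e by (auto simp: edges_on_def PiE_iff)
    thus "x (fst e j) < alph m" using x by auto
  qed
  fix U e es
  assume U: "finite U" and e: "e \<in> edges_on (arity m) U"
  show "weight_drop m lam * gibbs_Z (node_weight m lam) (alph m) (edge_weight m lam) U es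
    \<le> gibbs_Z (node_weight m lam) (alph m) (edge_weight m lam) U (add_mset e es)"
  proof (cases "m = IndSet")
    case True
    then show ?thesis using IndSet_gibbs_Z_add_ge[OF lam U] e by (simp add: weight_drop_def)
  next
    case False
    have "weight_lo m lam \<le> lam_pow lam (edge_pot m a y)" for a y
      using False m lam by (cases m) (auto simp: lam_pow_def intro!: powr_mono)
    thus ?thesis using False
      by (intro gibbs_Z_add_ge) (auto simp: weight_drop_def edge_weight_def lam_pow_nonneg node_weight_def)
  qed
qed auto

theorem theorem2:
  fixes m :: model and lam :: real
  assumes "valid_model m" and "lam \<ge> 1"
  shows "\<exists>z :: real \<Rightarrow> real.
           (\<forall>c>0. free_energy_conv_in_prob m lam c (z c))
         \<and> (\<exists>L. L-lipschitz_on {0<..} z)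
         \<and> ((m = MaxCut \<or> (\<exists>q. m = Coloring q) \<or> (\<exists>K. m = KSAT K) \<or> (\<exists>K. m = NAESAT K))
              \<longrightarrow> (\<forall>c c'. 0 < c \<and> c \<le> c' \<longrightarrow> z c \<le> z c'))
         \<and> (m = IndSet \<longrightarrow> (\<forall>c c'. 0 < c \<and> c \<le> c' \<longrightarrow> z c' \<le> z c))"
proof -
  note I = interpolation_model[OF assms]
  interpret interpolation "arity m" "alph m" "node_weight m lam" "edge_weight m lam"
    "spin_classes m" "\<lambda>s b y. of_bool (spin_match m s b y)"
    "weight_hi m lam" "1 - weight_lo m lam / weight_hi m lam" "weight_drop m lam" by (rule I)
  show ?thesis
  proof (intro exI[of _ z] conjI allI impI)
    show "free_energy_conv_in_prob m lam c (z c)" if "c > 0" for c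
      using free_energy_conv[OF I assms(2)] that by simp
    show "\<exists>L. L-lipschitz_on {0<..} z" using z_lipschitz by blast
  next
    fix c c' :: real
    assume "m = MaxCut \<or> (\<exists>q. m = Coloring q) \<or> (\<exists>K. m = KSAT K) \<or> (\<exists>K. m = NAESAT K)"
      and c: "0 < c \<and> c \<le> c'"
    \<comment> \<open>The least edge weight is 1 in these models, so the lower slope
      \<open>ln c0\<close> is 0.\<close>
    hence "weight_drop m lam = 1" by (auto simp: weight_drop_def)
    thus "z c \<le> z c'" using z_slope(1)[of c c'] c by simp
  next
    fix c c' :: real
    assume "m = IndSet" and c: "0 < c \<and> c \<le> c'"
    \<comment> \<open>No edge increases Z here: the upper slope \<open>ln A\<close> is 0.\<close>
    hence "weight_hi m lam = 1" by simp
    thus "z c' \<le> z c" using z_slope(2)[of c c'] c by simp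
  qed
qed

end
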